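(* Let $X, d$ be a continuous Yoneda-complete quasi-metric space. The $d_{\mathcal H}$-Scott topology, the $d_{\mathcal H}^a$-Scott topology, for every $a \in \mathbb{R}_+$, $a > 0$, and the lower Vietoris topology all coincide on $\mathcal H_0 X$, resp. $\mathcal H X$.
   Context: A quasi-metric on $X$ is a map $d \colon X \times X \to [0,+\infty]$ with $d(x,x)=0$, the triangle inequality, and $d(x,y)=d(y,x)=0 \Rightarrow x=y$. Formal balls are pairs $(x,r)$, $x\in X$, $r\in \mathbb{R}_+=[0,+\infty)$, ordered by $(x,r) \leq^{d^+} (y,s)$ iff $d(x,y) \leq r-s$; they form the poset $\mathbf{B}(X,d)$, with its Scott topology. For any quasi-metric space $X,d$, the $d$-Scott topology on $X$ is the coarsest one making $x \mapsto (x,0) \in \mathbf{B}(X,d)$ continuous; quasi-metric spaces are given that topology, and $X$ is viewed as a subspace of $\mathbf{B}(X,d)$ through that map. $X,d$ is continuous Yoneda-complete iff $\mathbf{B}(X,d)$ is a continuous dcpo. $\mathcal{H}_0 X$ is the set of closed subsets of $X$, and $\mathcal{H} X$ the set of non-empty closed subsets. For a closed subset $C$ of $X$ let $cl_{\mathbf B}(C)$ be its closure in $\mathbf{B}(X,d)$, and let $d(x,C) = \sup\{r \in \mathbb{R}_+ \mid (x,r) \notin cl_{\mathbf B}(C)\}$ (with $\sup\emptyset=0$). Then $d_{\mathcal H}(C,C') = \sup_{x\in C} d(x,C')$ (equal to $0$ if $C=\emptyset$), and $d_{\mathcal H}^a(C,C') = \min(a, d_{\mathcal H}(C,C'))$;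 both are quasi-metrics. The lower Vietoris topology is generated by the subbasic open sets $\{C \mid C \cap U \neq \emptyset\}$, $U$ open in $X$. *)

theory Defs
  imports "HOL-Analysis.Analysis" "HOL-Algebra.Order"
begin

subsection \<open>Posets, dcpos, and the Scott topology\<close>

definition directed_in :: "('p, 'm) gorder_scheme \<Rightarrow> 'p set \<Rightarrow> bool" where
  "directed_in L D \<longleftrightarrow> D \<subseteq> carrier L \<and> D \<noteq> {} \<and>
     (\<forall>x\<in>D. \<forall>y\<in>D. \<exists>z\<in>D. x \<sqsubseteq>\<^bsub>L\<^esub> z \<and> y \<sqsubseteq>\<^bsub>L\<^esub> z)"

definition is_sup :: "('p, 'm) gorder_scheme \<Rightarrow> 'p \<Rightarrow> 'p set \<Rightarrow> bool" where
  "is_sup L s D \<longleftrightarrow> least L s (Upper L D)"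

definition way_below :: "('p, 'm) gorder_scheme \<Rightarrow> 'p \<Rightarrow> 'p \<Rightarrow> bool" where
  "way_below L x y \<longleftrightarrow>
     (\<forall>D s. directed_in L D \<longrightarrow> is_sup L s D \<longrightarrow> y \<sqsubseteq>\<^bsub>L\<^esub> s \<longrightarrow> (\<exists>z\<in>D. x \<sqsubseteq>\<^bsub>L\<^esub> z))"

definition dcpo :: "('p, 'm) gorder_scheme \<Rightarrow> bool" where
  "dcpo L \<longleftrightarrow> partial_order L \<and> (\<forall>D. directed_in L D \<longrightarrow> (\<exists>s. is_sup L s D))"

definition continuous_dcpo :: "('p, 'm) gorder_scheme \<Rightarrow> bool" where
  "continuous_dcpo L \<longleftrightarrow> dcpo L \<and>
     (\<forall>y\<in>carrier L. directed_in L {x \<in> carrier L. way_below L x y} \<and>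
                     is_sup L y {x \<in> carrier L. way_below L x y})"

text \<open>The poset need not be a dcpo: only those directed sets that have a supremum matter.\<close>

definition scott_open :: "('p, 'm) gorder_scheme \<Rightarrow> 'p set \<Rightarrow> bool" where
  "scott_open L U \<longleftrightarrow> U \<subseteq> carrier L \<and>
     (\<forall>x\<in>U. \<forall>y\<in>carrier L. x \<sqsubseteq>\<^bsub>L\<^esub> y \<longrightarrow> y \<in> U) \<and>
     (\<forall>D s. directed_in L D \<longrightarrow> is_sup L s D \<longrightarrow> s \<in> U \<longrightarrow> D \<inter> U \<noteq> {})"

definition scott_topology :: "('p, 'm) gorder_scheme \<Rightarrow> 'p topology" where
  "scott_topology L = topology (scott_open L)"

lemma istopology_scott_open: "istopology (scott_open L)"
  unfolding istopology_def
proof (intro conjI allI impI)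
  fix U V assume U: "scott_open L U" and V: "scott_open L V"
  have "D \<inter> (U \<inter> V) \<noteq> {}" if D: "directed_in L D" and s: "is_sup L s D" "s \<in> U \<inter> V" for D s
  proof -
    obtain x where x: "x \<in> D" "x \<in> U" using U D s unfolding scott_open_def by blast
    obtain y where y: "y \<in> D" "y \<in> V" using V D s unfolding scott_open_def by blast
    obtain z where z: "z \<in> D" "x \<sqsubseteq>\<^bsub>L\<^esub> z" "y \<sqsubseteq>\<^bsub>L\<^esub> z"
      using D x y unfolding directed_in_def by blast
    then have "z \<in> carrier L" using D unfolding directed_in_def by blast
    then have "z \<in> U \<inter> V" using U V x y z unfolding scott_open_def by blast
    then show ?thesis using z by blast
  qed
  then show "scott_open L (U \<inter> V)"
    using U V unfolding scott_open_def by blast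
next
  fix \<K> assume K: "\<forall>K\<in>\<K>. scott_open L K"
  show "scott_open L (\<Union>\<K>)"
    unfolding scott_open_def
  proof (intro conjI ballI allI impI)
    show "\<Union>\<K> \<subseteq> carrier L"
      using K by (auto simp: scott_open_def)
    show "y \<in> \<Union>\<K>" if "x \<in> \<Union>\<K>" "y \<in> carrier L" "x \<sqsubseteq>\<^bsub>L\<^esub> y" for x y
      using K that unfolding scott_open_def by (meson UnionE UnionI)
    show "D \<inter> \<Union>\<K> \<noteq> {}" if D: "directed_in L D" "is_sup L s D" and "s \<in> \<Union>\<K>" for D s
    proof -
      obtain U where U: "U \<in> \<K>" "s \<in> U" using \<open>s \<in> \<Union>\<K>\<close> by blast
      then have "D \<inter> U \<noteq> {}" using K D unfolding scott_open_def by metis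
      then show ?thesis using U by blast
    qed
  qed
qed

lemma openin_scott_topology [simp]: "openin (scott_topology L) U \<longleftrightarrow> scott_open L U"
  by (simp add: scott_topology_def istopology_scott_open)

lemma topspace_scott_topology [simp]: "topspace (scott_topology L) = carrier L"
proof -
  have "scott_open L (carrier L)"
    unfolding scott_open_def directed_in_def by blast
  then show ?thesis
    unfolding topspace_def by (auto simp: scott_open_def)
qed

subsection \<open>Quasi-metric spaces and formal balls\<close>

definition quasi_metric :: "'a set \<Rightarrow> ('a \<Rightarrow> 'a \<Rightarrow> ennreal) \<Rightarrow> bool" where
  "quasi_metric X d \<longleftrightarrow>
     (\<forall>x\<in>X. d x x = 0) \<and>
     (\<forall>x\<in>X. \<forall>y\<in>X. \<forall>z\<in>X. d x z \<le> d x y + d y z) \<and>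
     (\<forall>x\<in>X. \<forall>y\<in>X. d x y = 0 \<longrightarrow> d y x = 0 \<longrightarrow> x = y)"

text \<open>The relation is $d(x,y) \leq r - s$. The conjunct \<open>s \<le> r\<close> is needed because
  \<^const>\<open>ennreal\<close> sends negative reals to $0$.\<close>

definition formal_balls :: "'a set \<Rightarrow> ('a \<Rightarrow> 'a \<Rightarrow> ennreal) \<Rightarrow> ('a \<times> real) gorder" where
  "formal_balls X d =
     \<lparr> carrier = X \<times> {0..},
       eq = (=),
       le = (\<lambda>(x, r) (y, s). s \<le> r \<and> d x y \<le> ennreal (r - s)) \<rparr>"

definition d_scott_topology :: "'a set \<Rightarrow> ('a \<Rightarrow> 'a \<Rightarrow> ennreal) \<Rightarrow> 'a topology" where
  "d_scott_topology X d = pullback_topology X (\<lambda>x. (x, 0)) (scott_topology (formal_balls X d))"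

definition continuous_yoneda_complete :: "'a set \<Rightarrow> ('a \<Rightarrow> 'a \<Rightarrow> ennreal) \<Rightarrow> bool" where
  "continuous_yoneda_complete X d \<longleftrightarrow> quasi_metric X d \<and> continuous_dcpo (formal_balls X d)"

lemma topspace_d_scott_topology [simp]: "topspace (d_scott_topology X d) = X"
  by (auto simp: d_scott_topology_def topspace_pullback_topology formal_balls_def)

lemma partial_order_formal_balls:
  assumes "quasi_metric X d"
  shows "partial_order (formal_balls X d)"
proof
  fix p q t
  assume "p \<sqsubseteq>\<^bsub>formal_balls X d\<^esub> q" "q \<sqsubseteq>\<^bsub>formal_balls X d\<^esub> t"
    and "p \<in> carrier (formal_balls X d)" "q \<in> carrier (formal_balls X d)"
      "t \<in> carrier (formal_balls X d)"
  moreover obtain x r y s z u where "p = (x, r)" "q = (y, s)" "t = (z, u)"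
    by (metis surj_pair)
  ultimately have *: "x \<in> X" "y \<in> X" "z \<in> X" "s \<le> r" "u \<le> s"
    "d x y \<le> ennreal (r - s)" "d y z \<le> ennreal (s - u)"
    and pt: "p = (x, r)" "t = (z, u)"
    by (auto simp: formal_balls_def)
  have "d x z \<le> d x y + d y z"
    using assms * unfolding quasi_metric_def by blast
  also have "\<dots> \<le> ennreal (r - s) + ennreal (s - u)"
    using * by (intro add_mono)
  also have "\<dots> = ennreal (r - u)"
    using * by (simp flip: ennreal_plus)
  finally show "p \<sqsubseteq>\<^bsub>formal_balls X d\<^esub> t"
    using * pt by (simp add: formal_balls_def)
next
  fix p q
  assume "p \<sqsubseteq>\<^bsub>formal_balls X d\<^esub> q" "q \<sqsubseteq>\<^bsub>formal_balls X d\<^esub> p"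
    "p \<in> carrier (formal_balls X d)" "q \<in> carrier (formal_balls X d)"
  then show "p .=\<^bsub>formal_balls X d\<^esub> q"
    using assms by (auto simp: formal_balls_def quasi_metric_def)
qed (use assms in \<open>auto simp: formal_balls_def quasi_metric_def\<close>)

subsection \<open>Hyperspaces\<close>

definition hyperspace0 :: "'a set \<Rightarrow> ('a \<Rightarrow> 'a \<Rightarrow> ennreal) \<Rightarrow> 'a set set" where
  "hyperspace0 X d = {C. closedin (d_scott_topology X d) C}"

definition hyperspace :: "'a set \<Rightarrow> ('a \<Rightarrow> 'a \<Rightarrow> ennreal) \<Rightarrow> 'a set set" where
  "hyperspace X d = {C. closedin (d_scott_topology X d) C \<and> C \<noteq> {}}"

definition ball_closure :: "'a set \<Rightarrow> ('a \<Rightarrow> 'a \<Rightarrow> ennreal) \<Rightarrow> 'a set \<Rightarrow> ('a \<times> real) set" where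
  "ball_closure X d C = scott_topology (formal_balls X d) closure_of ((\<lambda>x. (x, 0)) ` C)"

definition point_dist :: "'a set \<Rightarrow> ('a \<Rightarrow> 'a \<Rightarrow> ennreal) \<Rightarrow> 'a \<Rightarrow> 'a set \<Rightarrow> ennreal" where
  "point_dist X d x C = (SUP r \<in> {r::real. 0 \<le> r \<and> (x, r) \<notin> ball_closure X d C}. ennreal r)"

definition hausdorff_qm ::
    "'a set \<Rightarrow> ('a \<Rightarrow> 'a \<Rightarrow> ennreal) \<Rightarrow> 'a set \<Rightarrow> 'a set \<Rightarrow> ennreal" where
  "hausdorff_qm X d C C' = (SUP x\<in>C. point_dist X d x C')"

definition bounded_hausdorff_qm ::
    "real \<Rightarrow> 'a set \<Rightarrow> ('a \<Rightarrow> 'a \<Rightarrow> ennreal) \<Rightarrow> 'a set \<Rightarrow> 'a set \<Rightarrow> ennreal" where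
  "bounded_hausdorff_qm a X d C C' = min (ennreal a) (hausdorff_qm X d C C')"

text \<open>The set \<open>K\<close> is itself listed as a generator because the subbasic sets only cover the
  non-empty members of \<open>K\<close>.\<close>

definition lower_vietoris :: "'a topology \<Rightarrow> 'a set set \<Rightarrow> 'a set topology" where
  "lower_vietoris T K =
     topology_generated_by (insert K {{C \<in> K. C \<inter> U \<noteq> {}} | U. openin T U})"

lemma topspace_lower_vietoris [simp]: "topspace (lower_vietoris T K) = K"
  unfolding lower_vietoris_def topology_generated_by_topspace by blast

end

theory Submission
  imports Defs
begin

text \<open>
  The cut-off is treated as $A \in (0,\infty]$, where $A = \infty$ gives $d_{\mathcal H}$ itself; write
  $\mathbf B$ for the formal balls of $X$, and $C + r$ for the set of balls $(x,r)$ with $x \in C$.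

  For $V$ Scott-open in $\mathbf B$, the set of hyperspace balls $(C,r)$ with $r < A$ such that
  $C + r$ meets $V$ is Scott-open. Indeed a directed family $(C_i, r_i)$ with $r = \inf_i r_i$ has
  the upper bound $(C', r)$, where $C'$ consists of the centers of radius $0$ in the closure $F$ of
  the union of the $C_i + (r_i - r)$, taken over the $i$ with $r_i - r < A$. The point is that $F$ is
  the closure of $C'$, although $F$ is only known to be the closure of its balls of radius less than
  $\varepsilon$ for every $\varepsilon$: by interpolation, a chain for the way-below relation whose
  radii tend to $0$ ends in $C'$.

  Conversely, if $C$ is non-empty, $(C,0)$ is the directed supremum of the balls $(\downarrow E, t)$
  with $E$ finite and each $(y,t)$, $y \in E$, way below some $(x,0)$, $x \in C$. So a Scott-open
  neighbourhood of $(C,0)$ contains some $(\downarrow E, t)$, and then every $(C',0)$ such that $C'$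
  meets the open set of all $x$ with $(y,t)$ way below $(x,0)$, for each $y \in E$.
\<close>

section \<open>Suprema and Scott-closed and Scott-open sets in terms of the order\<close>

lemma is_sup_iff:
  assumes "D \<subseteq> carrier L"
  shows "is_sup L s D \<longleftrightarrow> s \<in> carrier L \<and> (\<forall>x\<in>D. x \<sqsubseteq>\<^bsub>L\<^esub> s) \<and>
    (\<forall>u\<in>carrier L. (\<forall>x\<in>D. x \<sqsubseteq>\<^bsub>L\<^esub> u) \<longrightarrow> s \<sqsubseteq>\<^bsub>L\<^esub> u)"
  using assms unfolding is_sup_def least_def Upper_def by blast

lemma closedin_scott_topology:
  "closedin (scott_topology L) F \<longleftrightarrow> F \<subseteq> carrier L \<and>
    (\<forall>x\<in>carrier L. \<forall>y\<in>F. x \<sqsubseteq>\<^bsub>L\<^esub> y \<longrightarrow> x \<in> F) \<and>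
    (\<forall>D s. directed_in L D \<longrightarrow> is_sup L s D \<longrightarrow> D \<subseteq> F \<longrightarrow> s \<in> F)"
proof -
  have "D \<inter> (carrier L - F) \<noteq> {} \<longleftrightarrow> \<not> D \<subseteq> F" if "directed_in L D" for D
    using that unfolding directed_in_def by blast
  moreover have "s \<in> carrier L" if "directed_in L D" "is_sup L s D" for D s
    using that unfolding is_sup_def least_def Upper_def by blast
  ultimately have
    "(\<forall>D s. directed_in L D \<longrightarrow> is_sup L s D \<longrightarrow> s \<in> carrier L - F \<longrightarrow> D \<inter> (carrier L - F) \<noteq> {}) \<longleftrightarrow>
      (\<forall>D s. directed_in L D \<longrightarrow> is_sup L s D \<longrightarrow> D \<subseteq> F \<longrightarrow> s \<in> F)"
    by (meson Diff_iff)
  moreover have "(\<forall>x\<in>carrier L - F. \<forall>y\<in>carrier L. x \<sqsubseteq>\<^bsub>L\<^esub> y \<longrightarrow> y \<in> carrier L - F) \<longleftrightarrow>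
      (\<forall>x\<in>carrier L. \<forall>y\<in>F. x \<sqsubseteq>\<^bsub>L\<^esub> y \<longrightarrow> x \<in> F)" if "F \<subseteq> carrier L"
    using that by blast
  ultimately show ?thesis
    unfolding closedin_def topspace_scott_topology openin_scott_topology scott_open_def
    by (simp only: Diff_subset simp_thms cong: conj_cong)
qed

lemma closedin_scott_sup:
  assumes "closedin (scott_topology L) F" "directed_in L D" "is_sup L s D" "D \<subseteq> F"
  shows "s \<in> F"
  by (rule assms(1)[unfolded closedin_scott_topology, THEN conjunct2, THEN conjunct2,
        rule_format, OF assms(2-4)])

lemma closedin_scott_down:
  assumes "closedin (scott_topology L) F" "y \<in> F" "x \<sqsubseteq>\<^bsub>L\<^esub> y" "x \<in> carrier L"
  shows "x \<in> F"
  by (rule assms(1)[unfolded closedin_scott_topology, THEN conjunct2, THEN conjunct1,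
        rule_format, OF assms(4,2,3)])

lemma scott_open_sup:
  assumes "scott_open L U" "directed_in L D" "is_sup L s D" "s \<in> U"
  shows "D \<inter> U \<noteq> {}"
  by (rule assms(1)[unfolded scott_open_def, THEN conjunct2, THEN conjunct2,
        rule_format, OF assms(2-4)])

lemma scott_open_up:
  assumes "scott_open L U" "x \<in> U" "x \<sqsubseteq>\<^bsub>L\<^esub> y" "y \<in> carrier L"
  shows "y \<in> U"
  by (rule assms(1)[unfolded scott_open_def, THEN conjunct2, THEN conjunct1,
        rule_format, OF assms(2,4,3)])

section \<open>The way-below relation in a continuous dcpo\<close>

locale continuous_poset = partial_order L for L :: "('p, 'm) gorder_scheme" (structure) +
  assumes cont: "continuous_dcpo L"
begin

lemma directed_sup: "directed_in L D \<Longrightarrow> \<exists>s. is_sup L s D"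
  using cont by (auto simp: continuous_dcpo_def dcpo_def)

lemma directed_way_below: "y \<in> carrier L \<Longrightarrow> directed_in L {x \<in> carrier L. way_below L x y}"
  using cont by (auto simp: continuous_dcpo_def)

lemma sup_way_below: "y \<in> carrier L \<Longrightarrow> is_sup L y {x \<in> carrier L. way_below L x y}"
  using cont by (auto simp: continuous_dcpo_def)

lemma way_below_imp_le:
  assumes "way_below L x y" "y \<in> carrier L"
  shows "x \<sqsubseteq> y"
proof -
  have "directed_in L {y}" "is_sup L y {y}"
    using assms by (auto simp: directed_in_def is_sup_iff)
  then show ?thesis
    using assms unfolding way_below_def by blast
qed

lemma way_below_le_trans:
  assumes "way_below L x y" "y \<sqsubseteq> z" "y \<in> carrier L" "z \<in> carrier L"
  shows "way_below L x z"
  unfolding way_below_def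
proof (intro allI impI)
  fix D s assume D: "directed_in L D" "is_sup L s D" "z \<sqsubseteq> s"
  then have "s \<in> carrier L"
    by (simp add: is_sup_iff directed_in_def)
  then have "y \<sqsubseteq> s"
    using D assms le_trans by blast
  then show "\<exists>z\<in>D. x \<sqsubseteq> z"
    using D assms unfolding way_below_def by blast
qed

lemma le_way_below_trans:
  assumes "x \<sqsubseteq> y" "way_below L y z" "x \<in> carrier L" "y \<in> carrier L"
  shows "way_below L x z"
  unfolding way_below_def
proof (intro allI impI)
  fix D s assume D: "directed_in L D" "is_sup L s D" "z \<sqsubseteq> s"
  then obtain w where "w \<in> D" "y \<sqsubseteq> w"
    using assms unfolding way_below_def by blast
  moreover have "w \<in> carrier L"
    using D \<open>w \<in> D\<close> unfolding directed_in_def by blast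
  ultimately show "\<exists>z\<in>D. x \<sqsubseteq> z"
    using assms le_trans by blast
qed

lemma way_below_directed:
  assumes "way_below L x z" "way_below L y z" "x \<in> carrier L" "y \<in> carrier L" "z \<in> carrier L"
  obtains w where "w \<in> carrier L" "way_below L w z" "x \<sqsubseteq> w" "y \<sqsubseteq> w"
  using directed_way_below[of z] assms unfolding directed_in_def by blast

text \<open>The elements two way-below steps under \<open>y\<close> form a directed set whose
  supremum is above \<open>y\<close>. So \<open>x\<close> lies under one of them, and the
  intermediate element of its two steps interpolates.\<close>

lemma interpolation:
  assumes x: "x \<in> carrier L" and y: "y \<in> carrier L" and xy: "way_below L x y"
  obtains z where "z \<in> carrier L" "way_below L x z" "way_below L z y"
proof -
  define D where "D = {z \<in> carrier L. \<exists>w\<in>carrier L. way_below L z w \<and> way_below L w y}"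
  have "directed_in L D"
    unfolding directed_in_def
  proof (intro conjI ballI)
    show "D \<subseteq> carrier L"
      by (auto simp: D_def)
    obtain w where w: "w \<in> carrier L" "way_below L w y"
      using directed_way_below[OF y] unfolding directed_in_def by blast
    obtain z where "z \<in> carrier L" "way_below L z w"
      using directed_way_below[OF w(1)] unfolding directed_in_def by blast
    then show "D \<noteq> {}"
      using w by (auto simp: D_def)
    fix a b assume "a \<in> D" "b \<in> D"
    then obtain v w where v: "a \<in> carrier L" "v \<in> carrier L" "way_below L a v" "way_below L v y"
      and w: "b \<in> carrier L" "w \<in> carrier L" "way_below L b w" "way_below L w y"
      by (auto simp: D_def)
    obtain u where u: "u \<in> carrier L" "way_below L u y" "v \<sqsubseteq> u" "w \<sqsubseteq> u"
      using way_below_directed[of v y w] v w y by metis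
    have "way_below L a u" "way_below L b u"
      using way_below_le_trans u v w by blast+
    then obtain c where "c \<in> carrier L" "way_below L c u" "a \<sqsubseteq> c" "b \<sqsubseteq> c"
      using way_below_directed[of a u b] u v w by metis
    then show "\<exists>c\<in>D. a \<sqsubseteq> c \<and> b \<sqsubseteq> c"
      using u by (auto simp: D_def)
  qed
  then obtain s where s: "is_sup L s D"
    using directed_sup by blast
  have DL: "D \<subseteq> carrier L"
    by (auto simp: D_def)
  have sL: "s \<in> carrier L"
    using s by (simp add: is_sup_iff DL)
  \<comment> \<open>An element is the supremum of the elements way below it; this is used first for
    every such \<open>w\<close>, then for \<open>y\<close>.\<close>
  have "w \<sqsubseteq> s" if w: "w \<in> carrier L" "way_below L w y" for w
  proof -
    have "\<forall>z \<in> {z \<in> carrier L. way_below L z w}. z \<sqsubseteq> s"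
      using s w by (auto simp: is_sup_iff DL) (auto simp: D_def)
    then show ?thesis
      using sup_way_below[OF w(1)] sL by (subst (asm) is_sup_iff) auto
  qed
  then have "y \<sqsubseteq> s"
    using sup_way_below[OF y] sL by (subst (asm) is_sup_iff) auto
  then obtain z where z: "z \<in> D" "x \<sqsubseteq> z"
    using xy s \<open>directed_in L D\<close> unfolding way_below_def by blast
  then obtain w where "z \<in> carrier L" "w \<in> carrier L" "way_below L z w" "way_below L w y"
    by (auto simp: D_def)
  then show ?thesis
    using that le_way_below_trans x z by blast
qed

text \<open>An interpolant between \<open>x\<close> and a directed supremum lies under some member
  of the directed set, and \<open>x\<close> is way below that member.\<close>

lemma scott_open_way_below:
  assumes x: "x \<in> carrier L"
  shows "scott_open L {y \<in> carrier L. way_below L x y}"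
  unfolding scott_open_def
proof (intro conjI ballI allI impI)
  fix D s assume D: "directed_in L D" "is_sup L s D" "s \<in> {y \<in> carrier L. way_below L x y}"
  then obtain z where z: "z \<in> carrier L" "way_below L x z" "way_below L z s"
    using interpolation[of x s] x by auto
  then obtain w where w: "w \<in> D" "z \<sqsubseteq> w"
    using D unfolding way_below_def[of L z s] by (metis (no_types, lifting) le_refl mem_Collect_eq)
  moreover have "w \<in> carrier L"
    using D w unfolding directed_in_def by blast
  ultimately show "D \<inter> {y \<in> carrier L. way_below L x y} \<noteq> {}"
    using way_below_le_trans z by blast
qed (use way_below_le_trans in auto)

end

section \<open>Shifting the radii of formal balls\<close>

text \<open>Negative \<open>u\<close> is allowed: a family is also shifted by minus the infimum of
  its radii, which moves that infimum to 0.\<close>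

definition ball_shift :: "real \<Rightarrow> 'a \<times> real \<Rightarrow> 'a \<times> real" where
  "ball_shift u p = (fst p, snd p + u)"

lemma ball_shift_simp [simp]: "ball_shift u (x, r) = (x, r + u)"
  by (simp add: ball_shift_def)

lemma formal_balls_simps [simp]:
  "carrier (formal_balls X d) = X \<times> {0..}"
  "(x, r) \<sqsubseteq>\<^bsub>formal_balls X d\<^esub> (y, s) \<longleftrightarrow> s \<le> r \<and> d x y \<le> ennreal (r - s)"
  by (auto simp: formal_balls_def)

lemma directed_ball_shift:
  assumes D: "directed_in (formal_balls X d) D" and u: "\<And>x r. (x, r) \<in> D \<Longrightarrow> 0 \<le> r + u"
  shows "directed_in (formal_balls X d) (ball_shift u ` D)"
  unfolding directed_in_def
proof (intro conjI ballI)
  show "ball_shift u ` D \<subseteq> carrier (formal_balls X d)" "ball_shift u ` D \<noteq> {}"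
    using D u by (fastforce simp: directed_in_def)+
  fix p q assume "p \<in> ball_shift u ` D" "q \<in> ball_shift u ` D"
  then obtain x r y s where p: "p = (x, r + u)" "(x, r) \<in> D" and q: "q = (y, s + u)" "(y, s) \<in> D"
    by (metis (no_types, lifting) ball_shift_simp imageE surj_pair)
  have "\<exists>v\<in>D. (x, r) \<sqsubseteq>\<^bsub>formal_balls X d\<^esub> v \<and> (y, s) \<sqsubseteq>\<^bsub>formal_balls X d\<^esub> v"
    using D p q unfolding directed_in_def by blast
  then obtain z t where z: "(z, t) \<in> D" "(x, r) \<sqsubseteq>\<^bsub>formal_balls X d\<^esub> (z, t)"
    "(y, s) \<sqsubseteq>\<^bsub>formal_balls X d\<^esub> (z, t)"
    by (metis surj_pair)
  then show "\<exists>v\<in>ball_shift u ` D. p \<sqsubseteq>\<^bsub>formal_balls X d\<^esub> v \<and> q \<sqsubseteq>\<^bsub>formal_balls X d\<^esub> v"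
    using p q by (intro bexI[of _ "ball_shift u (z, t)"] imageI) auto
qed

lemma is_sup_formal_balls:
  assumes "D \<subseteq> X \<times> {0..}"
  shows "is_sup (formal_balls X d) (y, s) D \<longleftrightarrow> y \<in> X \<and> 0 \<le> s \<and>
    (\<forall>(x, r)\<in>D. s \<le> r \<and> d x y \<le> ennreal (r - s)) \<and>
    (\<forall>z\<in>X. \<forall>t\<ge>0. (\<forall>(x, r)\<in>D. t \<le> r \<and> d x z \<le> ennreal (r - t)) \<longrightarrow>
      t \<le> s \<and> d y z \<le> ennreal (s - t))"
proof -
  have "is_sup (formal_balls X d) (y, s) D \<longleftrightarrow> (y, s) \<in> X \<times> {0..} \<and>
    (\<forall>p\<in>D. p \<sqsubseteq>\<^bsub>formal_balls X d\<^esub> (y, s)) \<and>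
    (\<forall>v\<in>X \<times> {0..}. (\<forall>p\<in>D. p \<sqsubseteq>\<^bsub>formal_balls X d\<^esub> v) \<longrightarrow> (y, s) \<sqsubseteq>\<^bsub>formal_balls X d\<^esub> v)"
    using assms by (subst is_sup_iff) auto
  then show ?thesis
    by (simp add: split_beta formal_balls_def) (auto simp: Ball_def)
qed

locale cont_yoneda =
  fixes X :: "'a set" and d :: "'a \<Rightarrow> 'a \<Rightarrow> ennreal"
  assumes cyc: "continuous_yoneda_complete X d"
begin

abbreviation B where "B \<equiv> formal_balls X d"

lemma qm: "quasi_metric X d"
  using cyc by (simp add: continuous_yoneda_complete_def)

lemma dist_refl [simp]: "x \<in> X \<Longrightarrow> d x x = 0"
  using qm by (simp add: quasi_metric_def)

sublocale balls: continuous_poset B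
  using cyc partial_order_formal_balls[OF qm]
  by (simp add: continuous_poset_def continuous_poset_axioms_def continuous_yoneda_complete_def)

text \<open>The radius of a directed supremum is the infimum \<open>m\<close> of the radii. By
  completeness the family lowered by \<open>m\<close> has a supremum too; its radius must be 0, and
  its center taken with radius \<open>m\<close> bounds the original family.\<close>

lemma sup_radius:
  assumes D: "directed_in B D" and s: "is_sup B (y, s) D" and e: "e > 0"
  shows "\<exists>x r. (x, r) \<in> D \<and> r < s + e"
proof (rule ccontr)
  assume "\<not> ?thesis"
  then have *: "s + e \<le> r" if "(x, r) \<in> D" for x r
    using that by (meson linorder_not_less)
  have DB: "D \<subseteq> X \<times> {0..}"
    using D by (simp add: directed_in_def)
  define m where "m = Inf (snd ` D)"
  have bdd: "bdd_below (snd ` D)"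
    using DB by (auto intro!: bdd_belowI[of _ 0])
  have m: "m \<le> r" if "(x, r) \<in> D" for x r
    unfolding m_def using that by (intro cInf_lower bdd) force
  have ne: "snd ` D \<noteq> {}"
    using D by (auto simp: directed_in_def)
  have "s + e \<le> m"
    unfolding m_def by (intro cInf_greatest ne) (use * in auto)
  have dir: "directed_in B (ball_shift (-m) ` D)"
    using m by (intro directed_ball_shift D) fastforce
  have SB: "ball_shift (-m) ` D \<subseteq> X \<times> {0..}"
    using DB m by fastforce
  obtain z t where "is_sup B (z, t) (ball_shift (-m) ` D)"
    using balls.directed_sup[OF dir] by (metis surj_pair)
  then have z: "z \<in> X" "0 \<le> t" "\<And>x r. (x, r) \<in> D \<Longrightarrow> t \<le> r - m \<and> d x z \<le> ennreal (r - m - t)"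
    using SB by (auto simp: is_sup_formal_balls split_beta)
  have "t + m \<le> Inf (snd ` D)"
    using z(3) by (intro cInf_greatest ne) force
  then have "t = 0"
    using z(2) by (simp add: m_def)
  then have "\<forall>(x, r)\<in>D. m \<le> r \<and> d x z \<le> ennreal (r - m)"
    using z by auto
  moreover have "0 \<le> s"
    using s DB by (simp add: is_sup_formal_balls)
  ultimately have "m \<le> s"
    using s z(1) DB \<open>s + e \<le> m\<close> e by (auto simp: is_sup_formal_balls)
  then show False
    using \<open>s + e \<le> m\<close> e by simp
qed

text \<open>The shifted family has some supremum \<open>(w, v)\<close>, which lies below
  \<open>(y, s + u)\<close>. As \<open>D\<close> contains radii close to \<open>s\<close>,
  \<open>v\<close> equals \<open>s + u\<close>. Shifted back, \<open>(w, s)\<close> bounds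
  \<open>D\<close>, so \<open>w\<close> and \<open>y\<close> have distance 0 in both
  directions.\<close>

lemma sup_ball_shift:
  assumes D: "directed_in B D" and s: "is_sup B (y, s) D" and u: "0 \<le> u"
  shows "is_sup B (y, s + u) (ball_shift u ` D)"
proof -
  have DB: "D \<subseteq> X \<times> {0..}"
    using D by (simp add: directed_in_def)
  have dir: "directed_in B (ball_shift u ` D)"
    using u DB by (intro directed_ball_shift D) fastforce
  have SB: "ball_shift u ` D \<subseteq> X \<times> {0..}"
    using DB u by fastforce
  note y = s[unfolded is_sup_formal_balls[OF DB]]
  obtain w v where wv: "is_sup B (w, v) (ball_shift u ` D)"
    using balls.directed_sup[OF dir] by (metis surj_pair)
  note w = wv[unfolded is_sup_formal_balls[OF SB]]
  have "\<forall>(x, r)\<in>ball_shift u ` D. s + u \<le> r \<and> d x y \<le> ennreal (r - (s + u))"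
    using y by (auto simp: ball_shift_def split_beta)
  then have wy: "s + u \<le> v" "d w y \<le> ennreal (v - (s + u))"
    using w y u by auto
  have "v \<le> s + u"
  proof (rule field_le_epsilon)
    fix e :: real assume "e > 0"
    then obtain x r where "(x, r) \<in> D" "r < s + e"
      using sup_radius[OF D s] by blast
    moreover have "v \<le> r + u"
      using w \<open>(x, r) \<in> D\<close> by force
    ultimately show "v \<le> s + u + e" by simp
  qed
  then have v: "v = s + u"
    using wy by simp
  have "\<forall>(x, r)\<in>D. s \<le> r \<and> d x w \<le> ennreal (r - s)"
    using w by (fastforce simp: v)
  then have "d y w \<le> ennreal (s - s)"
    using y w by blast
  moreover have "d w y = 0"
    using wy v by simp
  ultimately have "w = y"
    using qm w y unfolding quasi_metric_def by auto
  then show ?thesis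
    using wv v by simp
qed

lemma continuous_map_ball_shift:
  assumes u: "0 \<le> u"
  shows "continuous_map (scott_topology B) (scott_topology B) (ball_shift u)"
  unfolding continuous_map_def
proof (intro conjI allI impI)
  show "ball_shift u \<in> topspace (scott_topology B) \<rightarrow> topspace (scott_topology B)"
    using u by auto
  fix V assume "openin (scott_topology B) V"
  then have V: "scott_open B V" by simp
  let ?P = "{p \<in> topspace (scott_topology B). ball_shift u p \<in> V}"
  have "scott_open B ?P"
    unfolding scott_open_def
  proof (intro conjI ballI allI impI)
    fix p q assume *: "p \<in> ?P" "q \<in> carrier B" "p \<sqsubseteq>\<^bsub>B\<^esub> q"
    obtain x r y s where [simp]: "p = (x, r)" "q = (y, s)"
      by (metis surj_pair)
    have "ball_shift u p \<in> V" "ball_shift u q \<in> carrier B" "ball_shift u p \<sqsubseteq>\<^bsub>B\<^esub> ball_shift u q"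
      using * u by auto
    then show "q \<in> ?P"
      using V * unfolding scott_open_def by auto
  next
    fix D p assume *: "directed_in B D" "is_sup B p D" "p \<in> ?P"
    obtain y s where p [simp]: "p = (y, s)"
      by (metis surj_pair)
    have DB: "D \<subseteq> X \<times> {0..}"
      using * by (simp add: directed_in_def)
    have "directed_in B (ball_shift u ` D)"
      using u DB * by (intro directed_ball_shift) fastforce+
    then have "ball_shift u ` D \<inter> V \<noteq> {}"
      using V sup_ball_shift[of D y s u] * u unfolding scott_open_def by auto
    then show "D \<inter> ?P \<noteq> {}"
      using DB by auto
  qed auto
  then show "openin (scott_topology B) ?P" by simp
qed

section \<open>Balls as suprema of balls of larger radius, and closures in \<open>B\<close>\<close>

text \<open>This supremum turns Scott-openness and Scott-closedness into statements about small
  changes of the radius, in \<open>open_radius\<close> and \<open>closed_radius\<close>.\<close>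

lemma directed_radii:
  assumes "x \<in> X" "0 \<le> r"
  shows "directed_in B ((\<lambda>e. (x, r + e)) ` {0<..})" "is_sup B (x, r) ((\<lambda>e. (x, r + e)) ` {0<..})"
proof -
  show "directed_in B ((\<lambda>e. (x, r + e)) ` {0<..})"
    unfolding directed_in_def
  proof (intro conjI ballI)
    fix p q assume "p \<in> (\<lambda>e. (x, r + e)) ` {0<..}" "q \<in> (\<lambda>e. (x, r + e)) ` {0<..}"
    then obtain e f where "p = (x, r + e)" "q = (x, r + f)" "e > 0" "f > 0" by auto
    then show "\<exists>z\<in>(\<lambda>e. (x, r + e)) ` {0<..}. p \<sqsubseteq>\<^bsub>B\<^esub> z \<and> q \<sqsubseteq>\<^bsub>B\<^esub> z"
      using assms by (intro bexI[of _ "(x, r + min e f)"]) auto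
  qed (use assms in auto)
  have *: "t \<le> r \<and> d x z \<le> ennreal (r - t)"
    if *: "0 \<le> t" "\<And>e. e > 0 \<Longrightarrow> t \<le> r + e \<and> d x z \<le> ennreal (r + e - t)" for z t
  proof
    show "t \<le> r"
      by (rule field_le_epsilon) (use * in auto)
    show "d x z \<le> ennreal (r - t)"
    proof (rule ennreal_le_epsilon)
      fix e :: real assume "0 < e"
      then have "d x z \<le> ennreal (r - t + e)"
        using *(2)[of e] by (simp add: algebra_simps)
      then show "d x z \<le> ennreal (r - t) + ennreal e"
        using \<open>t \<le> r\<close> \<open>0 < e\<close> by (simp flip: ennreal_plus)
    qed
  qed
  show "is_sup B (x, r) ((\<lambda>e. (x, r + e)) ` {0<..})"
  proof (subst is_sup_formal_balls)
    let ?S = "(\<lambda>e. (x, r + e)) ` {0<..}"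
    have "\<forall>(y, s)\<in>?S. r \<le> s \<and> d y x \<le> ennreal (s - r)"
      using assms by simp
    moreover have "\<forall>z\<in>X. \<forall>t\<ge>0. (\<forall>(y, s)\<in>?S. t \<le> s \<and> d y z \<le> ennreal (s - t)) \<longrightarrow>
      t \<le> r \<and> d x z \<le> ennreal (r - t)"
    proof (intro ballI allI impI)
      fix z t assume "0 \<le> t" and S: "\<forall>(y, s)\<in>?S. t \<le> s \<and> d y z \<le> ennreal (s - t)"
      have "t \<le> r + e \<and> d x z \<le> ennreal (r + e - t)" if "e > 0" for e
        using bspec[OF S, of "(x, r + e)"] that by simp
      with \<open>0 \<le> t\<close> show "t \<le> r \<and> d x z \<le> ennreal (r - t)"
        by (rule *)
    qed
    ultimately show "x \<in> X \<and> 0 \<le> r \<and> (\<forall>(y, s)\<in>?S. r \<le> s \<and> d y x \<le> ennreal (s - r)) \<and>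
      (\<forall>z\<in>X. \<forall>t\<ge>0. (\<forall>(y, s)\<in>?S. t \<le> s \<and> d y z \<le> ennreal (s - t)) \<longrightarrow>
        t \<le> r \<and> d x z \<le> ennreal (r - t))"
      using assms by (intro conjI)
  qed (use assms in auto)
qed

lemma open_radius:
  assumes "scott_open B V" "(x, r) \<in> V"
  obtains e where "e > 0" "(x, r + e) \<in> V"
proof -
  have "x \<in> X" "0 \<le> r"
    using assms by (auto simp: scott_open_def)
  then have "(\<lambda>e. (x, r + e)) ` {0<..} \<inter> V \<noteq> {}"
    using scott_open_sup[OF assms(1) directed_radii assms(2)] by blast
  then show ?thesis
    using that by auto
qed

lemma closed_radius:
  assumes "closedin (scott_topology B) F" "x \<in> X" "0 \<le> r" "\<And>e. e > 0 \<Longrightarrow> (x, r + e) \<in> F"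
  shows "(x, r) \<in> F"
proof -
  have "(\<lambda>e. (x, r + e)) ` {0<..} \<subseteq> F"
    using assms by auto
  then show ?thesis
    using closedin_scott_sup assms(1) directed_radii[OF assms(2,3)] by metis
qed

lemma closedin_ball_closure: "closedin (scott_topology B) (ball_closure X d C)"
  by (simp add: ball_closure_def)

lemma center_in_ball_closure: "C \<subseteq> X \<Longrightarrow> x \<in> C \<Longrightarrow> (x, 0) \<in> ball_closure X d C"
  unfolding ball_closure_def
  by (rule subsetD[OF closure_of_subset]) auto

text \<open>The preimage of \<open>F\<close> under the shift by \<open>r\<close> is closed by
  continuity. It contains the balls of radius 0 over \<open>E\<close>, hence also their
  closure.\<close>

lemma ball_closure_shift:
  assumes F: "closedin (scott_topology B) F" and r: "0 \<le> r" and E: "\<And>x. x \<in> E \<Longrightarrow> (x, r) \<in> F"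
    and "p \<in> ball_closure X d E"
  shows "ball_shift r p \<in> F"
proof -
  have c: "closedin (scott_topology B) {p \<in> topspace (scott_topology B). ball_shift r p \<in> F}"
    using continuous_map_ball_shift[OF r] F by (rule closedin_continuous_map_preimage)
  have "(\<lambda>x. (x, 0)) ` E \<subseteq> {p \<in> topspace (scott_topology B). ball_shift r p \<in> F}"
    using E closedin_subset[OF F] by fastforce
  then show ?thesis
    using closure_of_minimal[OF _ c] assms(4) unfolding ball_closure_def by blast
qed

text \<open>Continuity of the shift, read on open sets: the preimage of \<open>V\<close> is an open
  neighbourhood of \<open>(x, s)\<close>, so it meets the balls of radius 0 over
  \<open>C\<close>.\<close>

lemma ball_closure_meets_open:
  assumes V: "scott_open B V" and r: "0 \<le> r" and xs: "(x, s) \<in> ball_closure X d C" "(x, s + r) \<in> V"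
  shows "\<exists>y\<in>C. (y, r) \<in> V"
proof -
  let ?P = "{p \<in> topspace (scott_topology B). ball_shift r p \<in> V}"
  have op: "openin (scott_topology B) ?P"
    using continuous_map_ball_shift[OF r] V by (intro openin_continuous_map_preimage) auto
  have P: "(x, s) \<in> ?P"
    using xs subsetD[OF closedin_subset[OF closedin_ball_closure] xs(1)] by simp
  obtain p where "p \<in> (\<lambda>x. (x, 0)) ` C" "p \<in> ?P"
    using xs(1)[unfolded ball_closure_def in_closure_of, THEN conjunct2, THEN spec, THEN mp,
        OF conjI[OF P op]] by (elim exE conjE)
  then show ?thesis
    by auto
qed

section \<open>The distance to a closed set and the Hausdorff quasi-metric\<close>

text \<open>The radii that put \<open>(x, r)\<close> into the closure form an up-set, which contains
  its infimum by \<open>closed_radius\<close>. So the supremum defining \<open>point_dist\<close>,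
  when finite, is itself such a radius.\<close>

lemma point_dist_le_iff:
  assumes x: "x \<in> X" and r: "0 \<le> r"
  shows "point_dist X d x C \<le> ennreal r \<longleftrightarrow> (x, r) \<in> ball_closure X d C"
proof
  assume le: "point_dist X d x C \<le> ennreal r"
  show "(x, r) \<in> ball_closure X d C"
  proof (rule closed_radius[OF closedin_ball_closure x r], rule ccontr)
    fix e :: real assume "e > 0" "(x, r + e) \<notin> ball_closure X d C"
    then have "ennreal (r + e) \<le> point_dist X d x C"
      unfolding point_dist_def using r by (intro SUP_upper) auto
    then have "ennreal (r + e) \<le> ennreal r"
      using le by (rule order_trans)
    then show False
      using r \<open>e > 0\<close> by simp
  qed
next
  assume *: "(x, r) \<in> ball_closure X d C"
  show "point_dist X d x C \<le> ennreal r"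
    unfolding point_dist_def
  proof (rule SUP_least, rule ccontr)
    fix s assume s: "s \<in> {r. 0 \<le> r \<and> (x, r) \<notin> ball_closure X d C}" "\<not> ennreal s \<le> ennreal r"
    then have "r < s"
      using ennreal_leI linorder_not_le by blast
    then have "(x, s) \<in> ball_closure X d C"
      using closedin_scott_down[OF closedin_ball_closure *, of "(x, s)"] x s by simp
    then show False
      using s by simp
  qed
qed

lemma hausdorff_qm_le_iff:
  assumes "C \<subseteq> X" "0 \<le> r"
  shows "hausdorff_qm X d C C' \<le> ennreal r \<longleftrightarrow> (\<forall>x\<in>C. (x, r) \<in> ball_closure X d C')"
  using assms by (auto simp: hausdorff_qm_def SUP_le_iff point_dist_le_iff subset_iff)

section \<open>Approximation by balls of small radius\<close>

text \<open>An interpolant \<open>q\<close> and a ball of radius below \<open>r + e\<close>, both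
  way below \<open>(x, r)\<close>, have a common upper bound that is still way below
  \<open>(x, r)\<close>; it inherits both properties.\<close>

lemma way_below_small_radius:
  assumes p: "p \<in> carrier B" and x: "x \<in> X" "0 \<le> r" and "way_below B p (x, r)" and e: "e > 0"
  obtains y t where "y \<in> X" "0 \<le> t" "way_below B (y, t) (x, r)" "way_below B p (y, t)" "t < r + e"
proof -
  have xB: "(x, r) \<in> carrier B"
    using x by simp
  obtain q where q: "q \<in> carrier B" "way_below B p q" "way_below B q (x, r)"
    using balls.interpolation[OF p xB] assms(4) by metis
  obtain z s where z: "z \<in> X" "0 \<le> s" "way_below B (z, s) (x, r)" "s < r + e"
    using sup_radius[OF balls.directed_way_below[OF xB] balls.sup_way_below[OF xB] e] by auto
  have zB: "(z, s) \<in> carrier B"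
    using z by simp
  obtain w where w: "w \<in> carrier B" "way_below B w (x, r)" "q \<sqsubseteq>\<^bsub>B\<^esub> w" "(z, s) \<sqsubseteq>\<^bsub>B\<^esub> w"
    using balls.way_below_directed[of q "(x, r)" "(z, s)"] q z(3) xB zB by metis
  obtain y t where [simp]: "w = (y, t)"
    by (metis surj_pair)
  show ?thesis
    using w z q balls.way_below_le_trans[of p q w] by (intro that[of y t]) auto
qed

text \<open>An ascending chain with radii tending to 0 is built in \<open>V\<close>, each ball being
  way below some member of \<open>F\<close>. As \<open>F\<close> is closed, it contains the chain
  and its supremum, which has radius 0.\<close>

lemma closed_meets_center:
  assumes F: "closedin (scott_topology B) F"
    and small: "\<And>V e. scott_open B V \<Longrightarrow> V \<inter> F \<noteq> {} \<Longrightarrow> e > 0 \<Longrightarrow> \<exists>(x, s)\<in>V \<inter> F. s < e"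
    and V: "scott_open B V" "V \<inter> F \<noteq> {}"
  shows "\<exists>x\<in>X. (x, 0) \<in> V \<inter> F"
proof -
  have FB: "F \<subseteq> carrier B"
    using closedin_subset[OF F] by simp
  \<comment> \<open>The last conjunct keeps the chain going: the balls that \<open>p\<close> is way
    below form an open set meeting \<open>F\<close>, so \<open>small\<close> finds a member of
    \<open>F\<close> of small radius in it.\<close>
  define P where "P p \<longleftrightarrow> p \<in> carrier B \<and> p \<in> V \<and> (\<exists>q\<in>F. way_below B p q)" for p
  obtain q where q: "q \<in> V" "q \<in> F"
    using V by blast
  then have "{x \<in> carrier B. way_below B x q} \<inter> V \<noteq> {}"
    using scott_open_sup[OF V(1) balls.directed_way_below balls.sup_way_below] FB by blast
  then have "\<exists>p. P p"
    using q unfolding P_def by blast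
  moreover have "\<exists>p'. P p' \<and> p \<sqsubseteq>\<^bsub>B\<^esub> p' \<and> snd p' < inverse (real (Suc n))" if Pp: "P p" for p n
  proof -
    obtain q where q: "q \<in> F" "way_below B p q" and p: "p \<in> carrier B" "p \<in> V"
      using Pp unfolding P_def by blast
    \<comment> \<open>Half of the target radius: the member of \<open>F\<close> has radius
      \<open>s < e\<close>, and the ball chosen way below it adds less than another
      \<open>e\<close>.\<close>
    define e where "e = inverse (real (Suc n)) / 2"
    have "e > 0"
      by (simp add: e_def)
    have "\<exists>(x, s)\<in>{y \<in> carrier B. way_below B p y} \<inter> F. s < e"
      using small[OF balls.scott_open_way_below[OF p(1)] _ \<open>e > 0\<close>] q FB by blast
    then obtain x s where x: "x \<in> X" "0 \<le> s" "(x, s) \<in> F" "way_below B p (x, s)" "s < e"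
      by auto
    obtain y t where y: "y \<in> X" "0 \<le> t" "way_below B (y, t) (x, s)" "way_below B p (y, t)" "t < s + e"
      using way_below_small_radius[OF p(1) x(1,2,4) \<open>e > 0\<close>] by metis
    have "t < inverse (real (Suc n))"
      using y x by (simp add: e_def)
    moreover have "p \<sqsubseteq>\<^bsub>B\<^esub> (y, t)"
      using balls.way_below_imp_le y by simp
    moreover have "(y, t) \<in> V"
      using scott_open_up[OF V(1) p(2) \<open>p \<sqsubseteq>\<^bsub>B\<^esub> (y, t)\<close>] y by simp
    ultimately show ?thesis
      using x y by (intro exI[of _ "(y, t)"]) (auto simp: P_def)
  qed
  ultimately obtain p where p: "\<And>n. P (p n)" "\<And>n. p n \<sqsubseteq>\<^bsub>B\<^esub> p (Suc n)"
    "\<And>n. snd (p (Suc n)) < inverse (real (Suc n))"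
    using dependent_nat_choice[of "\<lambda>_. P" "\<lambda>n p p'. p \<sqsubseteq>\<^bsub>B\<^esub> p' \<and> snd p' < inverse (real (Suc n))"]
    by metis
  have pB: "p n \<in> carrier B" for n
    using p(1) by (simp add: P_def)
  have mono: "p m \<sqsubseteq>\<^bsub>B\<^esub> p n" if "m \<le> n" for m n
    using that
  proof (induction rule: dec_induct)
    case (step n)
    then show ?case
      using balls.le_trans[of "p m" "p n" "p (Suc n)"] p(2) pB by blast
  qed (use pB balls.le_refl in blast)
  have dir: "directed_in B (range p)"
    unfolding directed_in_def
  proof (intro conjI ballI)
    fix a b assume "a \<in> range p" "b \<in> range p"
    then obtain m n where "a = p m" "b = p n" by blast
    then show "\<exists>c\<in>range p. a \<sqsubseteq>\<^bsub>B\<^esub> c \<and> b \<sqsubseteq>\<^bsub>B\<^esub> c"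
      using mono[of m "max m n"] mono[of n "max m n"] by auto
  qed (use pB in blast)+
  then obtain z s where z: "is_sup B (z, s) (range p)"
    using balls.directed_sup by (metis surj_pair)
  have up: "(z, s) \<in> carrier B" "\<And>n. p n \<sqsubseteq>\<^bsub>B\<^esub> (z, s)"
    using z pB is_sup_iff[of "range p" B] by blast+
  have "range p \<subseteq> F"
  proof
    fix a assume "a \<in> range p"
    then obtain n q where "a = p n" "q \<in> F" "way_below B (p n) q"
      using p(1) unfolding P_def by blast
    moreover have "p n \<sqsubseteq>\<^bsub>B\<^esub> q"
      using balls.way_below_imp_le calculation FB by blast
    ultimately show "a \<in> F"
      using closedin_scott_down[OF F _ _ pB] by blast
  qed
  then have "(z, s) \<in> F"
    by (rule closedin_scott_sup[OF F dir z])
  moreover have "(z, s) \<in> V"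
    using scott_open_up[OF V(1) _ up(2) up(1)] p(1)[of 0] unfolding P_def by blast
  moreover have "s = 0"
  proof (rule ccontr)
    assume "s \<noteq> 0"
    then have "s > 0"
      using up by simp
    then obtain n where "inverse (real (Suc n)) < s"
      using reals_Archimedean by blast
    moreover have "s \<le> snd (p (Suc n))"
      using up(2)[of "Suc n"] by (cases "p (Suc n)") simp
    ultimately show False
      using p(3)[of n] by simp
  qed
  ultimately show ?thesis
    using up by auto
qed


section \<open>The space \<open>X\<close> as a subspace of \<open>B\<close>\<close>

definition ball_trace :: "('a \<times> real) set \<Rightarrow> 'a set" where
  "ball_trace F = {x \<in> X. (x, 0) \<in> F}"

lemma ball_trace_iff: "x \<in> ball_trace F \<longleftrightarrow> x \<in> X \<and> (x, 0) \<in> F"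
  by (simp add: ball_trace_def)

lemma closedin_ball_trace:
  assumes F: "closedin (scott_topology B) F"
  shows "closedin (d_scott_topology X d) (ball_trace F)"
proof -
  have "continuous_map (d_scott_topology X d) (scott_topology B) (id \<circ> (\<lambda>x. (x, 0)))"
    unfolding d_scott_topology_def by (intro continuous_map_pullback continuous_map_id)
  from closedin_continuous_map_preimage[OF this F] show ?thesis
    by (simp add: ball_trace_def)
qed

lemma openin_d_scott_iff:
  "openin (d_scott_topology X d) U \<longleftrightarrow> (\<exists>V. scott_open B V \<and> U = {x \<in> X. (x, 0) \<in> V})"
proof -
  have "(\<lambda>x. (x, 0)) -` V \<inter> X = {x \<in> X. (x, 0) \<in> V}" for V :: "('a \<times> real) set"
    by auto
  then show ?thesis
    by (simp add: d_scott_topology_def openin_pullback_topology)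
qed

text \<open>Makes one radius available for finitely many balls at once. By openness
  \<open>(y, t)\<close> is way below \<open>(x, e)\<close> for all small \<open>e\<close>, and
  \<open>(x, e)\<close> is the supremum of the balls way below \<open>(x, 0)\<close> shifted by
  \<open>e\<close>.\<close>

lemma way_below_eventually:
  assumes y: "y \<in> X" "0 \<le> t" and x: "x \<in> X" and yx: "way_below B (y, t) (x, 0)"
  shows "\<forall>\<^sub>F e in at_right 0. \<exists>z\<in>X. way_below B (z, e) (x, 0) \<and> e \<le> t \<and> d y z \<le> ennreal (t - e)"
proof -
  have yB: "(y, t) \<in> carrier B" and xB: "(x, 0) \<in> carrier B"
    using y x by simp_all
  define D where "D = {p \<in> carrier B. way_below B p (x, 0)}"
  note dirD = balls.directed_way_below[OF xB, folded D_def]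
  note supD = balls.sup_way_below[OF xB, folded D_def]
  have yxU: "(x, 0) \<in> {q \<in> carrier B. way_below B (y, t) q}"
    using xB yx by (intro CollectI conjI)
  obtain b where b: "b > 0" "(x, 0 + b) \<in> {q \<in> carrier B. way_below B (y, t) q}"
    by (rule open_radius[OF balls.scott_open_way_below[OF yB] yxU])
  have "\<exists>z\<in>X. way_below B (z, e) (x, 0) \<and> e \<le> t \<and> d y z \<le> ennreal (t - e)"
    if e: "0 < e" "e < b" for e
  proof -
    have "way_below B (y, t) (x, e)"
      by (rule balls.way_below_le_trans[of "(y, t)" "(x, b)"]) (use b x e in auto)
    moreover have "directed_in B (ball_shift e ` D)"
      using e by (intro directed_ball_shift[OF dirD]) (auto simp: D_def)
    moreover have "is_sup B (x, e) (ball_shift e ` D)"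
      using sup_ball_shift[OF dirD supD, of e] e by simp
    moreover have "(x, e) \<sqsubseteq>\<^bsub>B\<^esub> (x, e)"
      using x by simp
    ultimately obtain p where p: "p \<in> D" "(y, t) \<sqsubseteq>\<^bsub>B\<^esub> ball_shift e p"
      unfolding way_below_def by blast
    \<comment> \<open>The ball \<open>(w, s)\<close> forces the radius \<open>v\<close> of the upper
      bound \<open>q = (z, v)\<close> below \<open>e\<close>. Then \<open>(z, e)\<close> lies below
      \<open>(z, v)\<close> and is still way below \<open>(x, 0)\<close>.\<close>
    obtain w s where w: "(w, s) \<in> D" "s < e"
      using sup_radius[OF dirD supD e(1)] by auto
    obtain q where q: "q \<in> D" "p \<sqsubseteq>\<^bsub>B\<^esub> q" "(w, s) \<sqsubseteq>\<^bsub>B\<^esub> q"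
      using dirD p(1) w(1) unfolding directed_in_def by blast
    obtain a u z v where [simp]: "p = (a, u)" "q = (z, v)"
      by (metis surj_pair)
    have a: "a \<in> X" "0 \<le> u" "z \<in> X" "0 \<le> v" "way_below B (z, v) (x, 0)" "v < e"
      using p q w by (auto simp: D_def)
    have "(y, t) \<sqsubseteq>\<^bsub>B\<^esub> (z, v + e)"
      using balls.le_trans[of "(y, t)" "(a, u + e)" "(z, v + e)"] p q a y e by auto
    then have "e \<le> t" "d y z \<le> ennreal (t - (v + e))"
      using a by auto
    moreover have "ennreal (t - (v + e)) \<le> ennreal (t - e)"
      using a by (intro ennreal_leI) simp
    moreover have "way_below B (z, e) (x, 0)"
      by (rule balls.le_way_below_trans[of "(z, e)" "(z, v)"]) (use a e in auto)
    ultimately show ?thesis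
      using a order_trans by blast
  qed
  then show ?thesis
    using b(1) by (auto simp: eventually_at_right_field)
qed

end

section \<open>Formal balls over a hyperspace with cut-off distance\<close>

text \<open>The two inclusions leave open only whether the empty set belongs to \<open>K\<close>, so
  both hyperspaces are treated together.\<close>

locale hyperspace_balls = cont_yoneda +
  fixes K :: "'a set set" and A :: ennreal
  assumes K: "hyperspace X d \<subseteq> K" "K \<subseteq> hyperspace0 X d" and A: "0 < A"
begin

abbreviation dK where "dK \<equiv> \<lambda>C C'. min A (hausdorff_qm X d C C')"
abbreviation H where "H \<equiv> formal_balls K dK"

lemma closed_K: "C \<in> K \<Longrightarrow> closedin (d_scott_topology X d) C"
  using K by (auto simp: hyperspace0_def)

lemma K_subset: "C \<in> K \<Longrightarrow> C \<subseteq> X"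
  using closedin_subset[OF closed_K] by simp

lemma in_K: "closedin (d_scott_topology X d) C \<Longrightarrow> C \<noteq> {} \<Longrightarrow> C \<in> K"
  using K by (auto simp: hyperspace_def)

text \<open>The first alternative is the effect of the cut-off: once the radii differ by at least
  \<open>A\<close>, any two sets are comparable.\<close>

lemma H_le_iff:
  assumes "C \<in> K"
  shows "(C, r) \<sqsubseteq>\<^bsub>H\<^esub> (C', s) \<longleftrightarrow>
    s \<le> r \<and> (A \<le> ennreal (r - s) \<or> (\<forall>x\<in>C. (x, r - s) \<in> ball_closure X d C'))"
  using K_subset[OF assms] by (auto simp: min_le_iff_disj hausdorff_qm_le_iff)

section \<open>Directed families of hyperspace balls and the open sets of balls hitting
  \<open>V\<close>\<close>

text \<open>A supremum of \<open>D\<close>, where it exists, lies below the bound constructed here.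
  The last clause carries a hit on \<open>C'\<close> back to a member of \<open>D\<close> with
  radius close to the infimum.\<close>

lemma directed_upper_bound:
  assumes D: "directed_in H D" and \<delta>: "\<delta> > 0" "ennreal \<delta> \<le> A"
  obtains C' where "C' \<in> K" "\<And>p. p \<in> D \<Longrightarrow> p \<sqsubseteq>\<^bsub>H\<^esub> (C', Inf (snd ` D))"
    "\<And>V x. scott_open B V \<Longrightarrow> x \<in> C' \<Longrightarrow> (x, Inf (snd ` D)) \<in> V \<Longrightarrow>
      \<exists>C t. (C, t) \<in> D \<and> t < Inf (snd ` D) + \<delta> \<and> (\<exists>y\<in>C. (y, t) \<in> V)"
proof -
  define m where "m = Inf (snd ` D)"
  \<comment> \<open>Radii in \<open>D'\<close> differ by less than \<open>\<delta> \<le> A\<close>,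
    so between members of \<open>D'\<close> the order always means inclusion in a closure, never the
    cut-off.\<close>
  define D' where "D' = {p \<in> D. snd p < m + \<delta>}"
  define S where "S = {(x, t - m) | x C t. (C, t) \<in> D' \<and> x \<in> C}"
  define F where "F = scott_topology B closure_of S"
  have DH: "D \<subseteq> K \<times> {0..}" and ne: "D \<noteq> {}"
    using D by (auto simp: directed_in_def)
  have bdd: "bdd_below (snd ` D)"
    using DH by (auto intro!: bdd_belowI[of _ 0])
  have m: "m \<le> t" if "(C, t) \<in> D" for C t
    unfolding m_def using that by (intro cInf_lower bdd) force
  have m0: "0 \<le> m"
    unfolding m_def using DH ne by (intro cInf_greatest) auto
  have near: "\<exists>C t. (C, t) \<in> D \<and> t < m + e" if "e > 0" for e
    using cInf_lessD[of "snd ` D" "m + e"] ne that by (force simp: m_def)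
  have dir: "\<exists>r\<in>D. p \<sqsubseteq>\<^bsub>H\<^esub> r \<and> q \<sqsubseteq>\<^bsub>H\<^esub> r" if "p \<in> D" "q \<in> D" for p q
    using D that by (simp add: directed_in_def)
  have cofinal: "\<exists>C' t'. (C', t') \<in> D' \<and> (C, t) \<sqsubseteq>\<^bsub>H\<^esub> (C', t') \<and> t' < m + e"
    if C: "(C, t) \<in> D" and e: "e > 0" for C t e
  proof -
    obtain C1 t1 where 1: "(C1, t1) \<in> D" "t1 < m + min e \<delta>"
      using near[of "min e \<delta>"] e \<delta> by auto
    obtain C2 t2 where 2: "(C2, t2) \<in> D" "(C, t) \<sqsubseteq>\<^bsub>H\<^esub> (C2, t2)" "(C1, t1) \<sqsubseteq>\<^bsub>H\<^esub> (C2, t2)"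
      using dir[OF C 1(1)] by (metis surj_pair)
    then have "t2 \<le> t1"
      by simp
    then have "t2 < m + \<delta>" "t2 < m + e"
      using 1(2) by linarith+
    then show ?thesis
      using 2 by (auto simp: D'_def simp del: formal_balls_simps)
  qed
  have D'_K: "C \<in> K" "m \<le> t" "t < m + \<delta>" if "(C, t) \<in> D'" for C t
    using that DH m by (auto simp: D'_def)
  have D'_le: "(x, t - t') \<in> ball_closure X d C'"
    if "(C, t) \<in> D'" "(C', t') \<in> D'" "(C, t) \<sqsubseteq>\<^bsub>H\<^esub> (C', t')" "x \<in> C" for C t C' t' x
  proof -
    have "ennreal (t - t') < ennreal \<delta>"
      using D'_K[OF that(1)] D'_K[OF that(2)] \<delta> by (intro ennreal_lessI) auto
    then have "\<not> A \<le> ennreal (t - t')"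
      using \<delta> by (metis leD order_less_le_trans)
    then show ?thesis
      using that(3,4) H_le_iff[OF D'_K(1)[OF that(1)]] by blast
  qed
  have SB: "S \<subseteq> topspace (scott_topology B)"
    using D'_K K_subset by (fastforce simp: S_def)
  have F: "closedin (scott_topology B) F"
    by (simp add: F_def)
  have SF: "S \<subseteq> F"
    unfolding F_def by (rule closure_of_subset[OF SB])
  have meets_S: "\<exists>x C t. (C, t) \<in> D' \<and> x \<in> C \<and> (x, t - m) \<in> V"
    if V: "scott_open B V" "p \<in> F" "p \<in> V" for V p
  proof -
    have "openin (scott_topology B) V"
      using V by simp
    then obtain q where "q \<in> S" "q \<in> V"
      using V(2)[unfolded F_def in_closure_of, THEN conjunct2, THEN spec, THEN mp, OF conjI[OF V(3)]]
      by blast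
    then show ?thesis
      by (auto simp: S_def)
  qed
  \<comment> \<open>The hypothesis of \<open>closed_meets_center\<close>: a hit of \<open>V\<close>
    by one member of \<open>D'\<close> is passed on to a larger member whose radius is within
    \<open>e\<close> of \<open>m\<close>.\<close>
  have small: "\<exists>(x, s)\<in>V \<inter> F. s < e" if V: "scott_open B V" "V \<inter> F \<noteq> {}" and e: "e > 0" for V e
  proof -
    obtain p where "p \<in> F" "p \<in> V"
      using V by blast
    then obtain x C t where x: "(C, t) \<in> D'" "x \<in> C" "(x, t - m) \<in> V"
      using meets_S V(1) by metis
    then obtain C2 t2 where 2: "(C2, t2) \<in> D'" "(C, t) \<sqsubseteq>\<^bsub>H\<^esub> (C2, t2)" "t2 < m + e"
      using cofinal[of C t e] e by (auto simp: D'_def)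
    have "\<exists>y\<in>C2. (y, t2 - m) \<in> V"
      using D'_K(2)[OF 2(1)] x(3)
      by (intro ball_closure_meets_open[OF V(1) _ D'_le[OF x(1) 2(1,2) x(2)]]) simp_all
    then obtain y where y: "y \<in> C2" "(y, t2 - m) \<in> V"
      by blast
    then have "(y, t2 - m) \<in> S"
      using 2 by (auto simp: S_def)
    then show ?thesis
      using y 2 SF by (intro bexI[of _ "(y, t2 - m)"]) auto
  qed
  define C' where "C' = ball_trace F"
  have C'X: "C' \<subseteq> X"
    by (auto simp: C'_def ball_trace_def)
  \<comment> \<open>Otherwise the complement of the closure of \<open>C'\<close> is an open set
    meeting \<open>F\<close>, hence contains a ball of radius 0 from \<open>F\<close>; but the
    center of such a ball is in \<open>C'\<close>.\<close>
  have F_sub: "F \<subseteq> ball_closure X d C'"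
  proof (rule ccontr)
    let ?V = "carrier B - ball_closure X d C'"
    assume "\<not> ?thesis"
    then have "?V \<inter> F \<noteq> {}"
      using closedin_subset[OF F] by auto
    moreover have "scott_open B ?V"
      using closedin_ball_closure[of C'] by (simp add: closedin_def)
    ultimately obtain x where "x \<in> X" "(x, 0) \<in> ?V \<inter> F"
      using closed_meets_center[OF F small] by blast
    then show False
      using center_in_ball_closure[OF C'X, of x] by (auto simp: C'_def ball_trace_def)
  qed
  have S_sub: "(x, t - m) \<in> ball_closure X d C'" if "(C, t) \<in> D'" "x \<in> C" for x C t
    using that SF F_sub by (auto simp: S_def)
  \<comment> \<open>If \<open>C'\<close> is empty, then so is some member of \<open>D'\<close>, and
    thus the empty set belongs to \<open>K\<close>.\<close>
  have "C' \<in> K"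
  proof (cases "C' = {}")
    case True
    then have "ball_closure X d C' = {}"
      by (simp add: ball_closure_def)
    moreover obtain C t where "(C, t) \<in> D'"
      using near[OF \<delta>(1)] by (auto simp: D'_def)
    ultimately have "C = {}"
      using S_sub by blast
    then show ?thesis
      using D'_K(1)[OF \<open>(C, t) \<in> D'\<close>] True by simp
  next
    case False
    then show ?thesis
      unfolding C'_def by (intro in_K closedin_ball_trace F)
  qed
  moreover have "p \<sqsubseteq>\<^bsub>H\<^esub> (C', Inf (snd ` D))" if p: "p \<in> D" for p
  proof -
    obtain C t where [simp]: "p = (C, t)"
      by (metis surj_pair)
    obtain C2 t2 where 2: "(C2, t2) \<in> D'" "(C, t) \<sqsubseteq>\<^bsub>H\<^esub> (C2, t2)"
      using cofinal[of C t 1] p by auto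
    have CK: "C \<in> K"
      using p DH by auto
    note le = 2(2)[unfolded H_le_iff[OF CK]]
    have mt: "m \<le> t2"
      using D'_K(2)[OF 2(1)] .
    \<comment> \<open>Either the cut-off already applies between \<open>t\<close> and
      \<open>t2\<close>, and then also between \<open>t\<close> and \<open>m\<close>, or the
      inclusion of \<open>C\<close> in the closure of \<open>C2\<close> is composed with the shifted
      inclusion of \<open>C2\<close> in the closure of \<open>C'\<close>.\<close>
    show ?thesis
    proof (cases "A \<le> ennreal (t - t2)")
      case True
      also have "ennreal (t - t2) \<le> ennreal (t - m)"
        using mt by (intro ennreal_leI) simp
      finally show ?thesis
        using le mt by (simp add: H_le_iff[OF CK] del: formal_balls_simps flip: m_def)
    next
      case False
      have "(x, t - m) \<in> ball_closure X d C'" if "x \<in> C" for x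
      proof -
        have "(x, t - t2) \<in> ball_closure X d C2"
          using le False that by blast
        then have "ball_shift (t2 - m) (x, t - t2) \<in> ball_closure X d C'"
          using mt S_sub[OF 2(1)] by (intro ball_closure_shift[OF closedin_ball_closure]) auto
        then show ?thesis
          by simp
      qed
      then show ?thesis
        using le mt by (simp add: H_le_iff[OF CK] del: formal_balls_simps flip: m_def)
    qed
  qed
  moreover have "\<exists>C t. (C, t) \<in> D \<and> t < Inf (snd ` D) + \<delta> \<and> (\<exists>y\<in>C. (y, t) \<in> V)"
    if V: "scott_open B V" and x: "x \<in> C'" "(x, Inf (snd ` D)) \<in> V" for V x
  proof -
    let ?P = "{p \<in> topspace (scott_topology B). ball_shift m p \<in> V}"
    have "openin (scott_topology B) ?P"
      using continuous_map_ball_shift[OF m0] V by (intro openin_continuous_map_preimage) auto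
    then have P: "scott_open B ?P"
      by simp
    have xP: "(x, 0) \<in> ?P" and xF: "(x, 0) \<in> F"
      using x by (auto simp: C'_def ball_trace_def m_def)
    obtain y C t where "(C, t) \<in> D'" "y \<in> C" "(y, t - m) \<in> ?P"
      using meets_S[OF P xF xP] by (elim exE conjE)
    then show ?thesis
      by (intro exI[of _ C] exI[of _ t]) (auto simp: D'_def m_def)
  qed
  ultimately show ?thesis
    by (rule that)
qed

text \<open>The bound \<open>r < A\<close> keeps the cut-off away: above \<open>(C, r)\<close> the
  radius drops by at most \<open>r\<close>, so the order yields a true inclusion in a closure, and
  \<open>ball_closure_meets_open\<close> transfers the hit.\<close>

lemma scott_open_hit:
  assumes V: "scott_open B V"
  shows "scott_open H {(C, r). C \<in> K \<and> 0 \<le> r \<and> ennreal r < A \<and> (\<exists>x\<in>C. (x, r) \<in> V)}"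
    (is "scott_open H ?W")
  unfolding scott_open_def
proof (intro conjI ballI allI impI)
  show "?W \<subseteq> carrier H"
    by auto
next
  fix p q assume p: "p \<in> ?W" and q: "q \<in> carrier H" and le: "p \<sqsubseteq>\<^bsub>H\<^esub> q"
  obtain C r C' s where [simp]: "p = (C, r)" "q = (C', s)"
    by (metis surj_pair)
  obtain x where x: "C \<in> K" "ennreal r < A" "x \<in> C" "(x, r) \<in> V"
    using p by auto
  have s: "0 \<le> s" "s \<le> r" "C' \<in> K"
    using q le by auto
  have "ennreal (r - s) \<le> ennreal r" "ennreal s \<le> ennreal r"
    using s by (auto intro: ennreal_leI)
  then have *: "ennreal (r - s) < A" "ennreal s < A"
    using x(2) by (auto intro: order_le_less_trans)
  then have mem: "(x, r - s) \<in> ball_closure X d C'"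
    using le x(3) by (auto simp: H_le_iff[OF x(1)] simp del: formal_balls_simps)
  then have "\<exists>y\<in>C'. (y, s) \<in> V"
    using x(4) by (intro ball_closure_meets_open[OF V s(1) mem]) simp
  then show "q \<in> ?W"
    using s * by auto
next
  fix D p assume D: "directed_in H D" "is_sup H p D" and p: "p \<in> ?W"
  obtain C r where [simp]: "p = (C, r)"
    by (metis surj_pair)
  obtain x where x: "C \<in> K" "0 \<le> r" "ennreal r < A" "x \<in> C" "(x, r) \<in> V"
    using p by auto
  \<comment> \<open>A real \<open>q\<close> strictly between \<open>r\<close> and \<open>A\<close>:
    for \<open>\<delta> = q - r\<close>, the member of \<open>D\<close> found in the end has radius
    below \<open>q\<close>, hence below \<open>A\<close>.\<close>
  obtain b where "ennreal r < b" "b < A"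
    using dense[OF x(3)] by blast
  moreover obtain q where "b = ennreal q" "0 \<le> q"
    using \<open>b < A\<close> by (cases b) auto
  ultimately have q: "r < q" "ennreal q < A"
    using x(2) by (auto simp: ennreal_less_iff)
  have \<delta>: "0 < q - r" "ennreal (q - r) \<le> A"
  proof -
    have "ennreal (q - r) \<le> ennreal q"
      using x by (intro ennreal_leI) simp
    then show "ennreal (q - r) \<le> A"
      using q by simp
  qed (use q in simp)
  let ?m = "Inf (snd ` D)"
  obtain C' where C': "C' \<in> K" "\<And>p. p \<in> D \<Longrightarrow> p \<sqsubseteq>\<^bsub>H\<^esub> (C', ?m)"
    and hit: "\<And>V x. scott_open B V \<Longrightarrow> x \<in> C' \<Longrightarrow> (x, ?m) \<in> V \<Longrightarrow>
      \<exists>C t. (C, t) \<in> D \<and> t < ?m + (q - r) \<and> (\<exists>y\<in>C. (y, t) \<in> V)"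
    using directed_upper_bound[OF D(1) \<delta>] by metis
  have DH: "D \<subseteq> K \<times> {0..}" and ne: "D \<noteq> {}"
    using D by (auto simp: directed_in_def)
  note sup = D(2)[unfolded is_sup_iff[OF DH[folded formal_balls_simps(1)[of K dK]]]]
  have "r \<le> ?m"
  proof (rule cInf_greatest)
    fix t assume "t \<in> snd ` D"
    then obtain C1 where "(C1, t) \<in> D"
      by force
    then have "(C1, t) \<sqsubseteq>\<^bsub>H\<^esub> (C, r)"
      using sup by (simp del: formal_balls_simps)
    then show "r \<le> t"
      by simp
  qed (use ne in simp)
  have m0: "0 \<le> ?m"
    using DH ne by (intro cInf_greatest) auto
  then have "(C', ?m) \<in> carrier H"
    using C' by simp
  \<comment> \<open>The supremum is below the upper bound \<open>(C', ?m)\<close>, so the radii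
    agree; since \<open>A\<close> is positive, \<open>C\<close> lies in the closure of
    \<open>C'\<close>.\<close>
  then have le: "(C, r) \<sqsubseteq>\<^bsub>H\<^esub> (C', ?m)"
    using sup C'(2) by (simp del: formal_balls_simps)
  then have "?m = r"
    using \<open>r \<le> ?m\<close> by simp
  then have mem: "(x, 0) \<in> ball_closure X d C'"
    using le x(4) A by (auto simp: H_le_iff[OF x(1)] simp del: formal_balls_simps)
  then have "\<exists>y\<in>C'. (y, r) \<in> V"
    using x(5) by (intro ball_closure_meets_open[OF V x(2) mem]) simp
  then obtain C1 t where t: "(C1, t) \<in> D" "t < r + (q - r)" "\<exists>y\<in>C1. (y, t) \<in> V"
    using hit[OF V] \<open>?m = r\<close> by metis
  moreover have "ennreal t < A"
    using t(2) q by (intro order_le_less_trans[OF ennreal_leI, of t q A]) auto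
  ultimately have "(C1, t) \<in> D \<inter> ?W"
    using DH by auto
  then show "D \<inter> ?W \<noteq> {}"
    by blast
qed

lemma openin_hit:
  assumes "openin (d_scott_topology X d) U"
  shows "openin (d_scott_topology K dK) {C \<in> K. C \<inter> U \<noteq> {}}"
proof -
  obtain V where V: "scott_open B V" "U = {x \<in> X. (x, 0) \<in> V}"
    using assms by (auto simp: openin_d_scott_iff)
  let ?W = "{(C, r). C \<in> K \<and> 0 \<le> r \<and> ennreal r < A \<and> (\<exists>x\<in>C. (x, r) \<in> V)}"
  have "openin (scott_topology H) ?W"
    using scott_open_hit[OF V(1)] by simp
  moreover have "{C \<in> K. C \<inter> U \<noteq> {}} = (\<lambda>C. (C, 0)) -` ?W \<inter> K"
    using A V(2) K_subset by (auto 4 3)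
  ultimately show ?thesis
    unfolding d_scott_topology_def openin_pullback_topology by blast
qed

section \<open>Approximation of a non-empty closed set by finite sets\<close>

text \<open>For \<open>E \<subseteq> X\<close> this is the closure of \<open>E\<close> in
  \<open>X\<close>. If \<open>E\<close> is finite, it consists of the \<open>x\<close> with
  \<open>d x y = 0\<close> for some \<open>y \<in> E\<close>.\<close>

definition down_hull :: "'a set \<Rightarrow> 'a set" where
  "down_hull E = ball_trace (ball_closure X d E)"

lemma down_hull_subset: "E \<subseteq> X \<Longrightarrow> E \<subseteq> down_hull E"
  using center_in_ball_closure[of E] by (auto simp: down_hull_def ball_trace_iff)

lemma down_hull_in_K: "E \<subseteq> X \<Longrightarrow> E \<noteq> {} \<Longrightarrow> down_hull E \<in> K"
  using down_hull_subset[of E] unfolding down_hull_def by (intro in_K closedin_ball_trace closedin_ball_closure) auto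

text \<open>By \<open>ball_closure_shift\<close>, inclusion in a closure passes from the generators
  \<open>E\<close> to their closure.\<close>

lemma down_hull_le:
  assumes "E \<subseteq> X" "E \<noteq> {}" "s \<le> r" and E: "\<And>y. y \<in> E \<Longrightarrow> (y, r - s) \<in> ball_closure X d C"
  shows "(down_hull E, r) \<sqsubseteq>\<^bsub>H\<^esub> (C, s)"
proof -
  have "(x, r - s) \<in> ball_closure X d C" if "x \<in> down_hull E" for x
    using ball_closure_shift[OF closedin_ball_closure _ E, where p = "(x, 0)"] that assms(3)
    by (simp add: down_hull_def ball_trace_iff)
  then show ?thesis
    using assms(3) by (simp add: H_le_iff[OF down_hull_in_K[OF assms(1,2)]] del: formal_balls_simps)
qed

text \<open>All points of \<open>E\<close> share the radius \<open>t\<close>, so that the whole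
  approximant becomes the single hyperspace ball \<open>(down_hull E, t)\<close>.\<close>

definition approximants :: "'a set \<Rightarrow> ('a set \<times> real) set" where
  "approximants C = {(E, t). finite E \<and> E \<noteq> {} \<and> E \<subseteq> X \<and> 0 \<le> t \<and>
     (\<forall>y\<in>E. \<exists>x\<in>C. way_below B (y, t) (x, 0))}"

lemma approximants_iff:
  "(E, t) \<in> approximants C \<longleftrightarrow> finite E \<and> E \<noteq> {} \<and> E \<subseteq> X \<and> 0 \<le> t \<and>
     (\<forall>y\<in>E. \<exists>x\<in>C. way_below B (y, t) (x, 0))"
  by (simp add: approximants_def)

text \<open>Given two approximants, \<open>way_below_eventually\<close> at each of their finitely
  many points yields one small radius \<open>e\<close> at which all points can be refined. The
  refinements of both, taken together, give an upper bound.\<close>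

lemma directed_approximants:
  assumes C: "C \<in> K" "C \<noteq> {}"
  shows "directed_in H ({(down_hull E, t) | E t. (E, t) \<in> approximants C})"
  unfolding directed_in_def
proof (intro conjI ballI)
  show "{(down_hull E, t) | E t. (E, t) \<in> approximants C} \<subseteq> carrier H"
    using down_hull_in_K by (auto simp: approximants_def)
  obtain x where x: "x \<in> C" "x \<in> X"
    using C K_subset by blast
  then have xB: "(x, 0) \<in> carrier B"
    by simp
  obtain p where "p \<in> carrier B" "way_below B p (x, 0)"
    using balls.directed_way_below[OF xB] unfolding directed_in_def by blast
  then have "({fst p}, snd p) \<in> approximants C"
    using x by (auto simp: approximants_def)
  then show "{(down_hull E, t) | E t. (E, t) \<in> approximants C} \<noteq> {}"
    by blast
next
  fix p q assume "p \<in> {(down_hull E, t) | E t. (E, t) \<in> approximants C}" "q \<in> {(down_hull E, t) | E t. (E, t) \<in> approximants C}"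
  then obtain E1 t1 E2 t2 where p: "p = (down_hull E1, t1)" "(E1, t1) \<in> approximants C"
    and q: "q = (down_hull E2, t2)" "(E2, t2) \<in> approximants C"
    by auto
  define P where "P t e y z \<longleftrightarrow> z \<in> X \<and> (\<exists>x\<in>C. way_below B (z, e) (x, 0)) \<and> e \<le> t \<and> d y z \<le> ennreal (t - e)"
    for t e y z
  have ev: "\<forall>\<^sub>F e in at_right 0. \<forall>y\<in>E. \<exists>z. P t e y z" if Et: "(E, t) \<in> approximants C" for E t
  proof (rule eventually_ball_finite)
    show "finite E"
      using Et by (simp add: approximants_def)
    show "\<forall>y\<in>E. \<forall>\<^sub>F e in at_right 0. \<exists>z. P t e y z"
    proof
      fix y assume y: "y \<in> E"
      then obtain x where x: "x \<in> C" "way_below B (y, t) (x, 0)" "y \<in> X" "0 \<le> t"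
        using Et unfolding approximants_iff by blast
      have "\<forall>\<^sub>F e in at_right 0. \<exists>z\<in>X. way_below B (z, e) (x, 0) \<and> e \<le> t \<and> d y z \<le> ennreal (t - e)"
        using x C K_subset by (intro way_below_eventually) auto
      then show "\<forall>\<^sub>F e in at_right 0. \<exists>z. P t e y z"
        using x(1) by (auto simp: P_def elim!: eventually_mono)
    qed
  qed
  have "\<forall>\<^sub>F e in at_right 0. 0 < e \<and> (\<forall>y\<in>E1. \<exists>z. P t1 e y z) \<and> (\<forall>y\<in>E2. \<exists>z. P t2 e y z)"
    by (intro eventually_conj ev p q eventually_at_right_less)
  then obtain e :: real where e: "0 < e" "\<forall>y\<in>E1. \<exists>z. P t1 e y z" "\<forall>y\<in>E2. \<exists>z. P t2 e y z"
    using eventually_happens' trivial_limit_at_right_real by blast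
  obtain f g where f: "\<forall>y\<in>E1. P t1 e y (f y)" and g: "\<forall>y\<in>E2. P t2 e y (g y)"
    using e by metis
  define E where "E = f ` E1 \<union> g ` E2"
  have E: "(E, e) \<in> approximants C"
    using p q f g e(1) by (auto simp: E_def approximants_def P_def)
  have EX: "E \<subseteq> X"
    using E by (simp add: approximants_def)
  have le: "(down_hull E', t) \<sqsubseteq>\<^bsub>H\<^esub> (down_hull E, e)"
    if "(E', t) \<in> approximants C" and h: "\<forall>y\<in>E'. P t e y (h y)" "h ` E' \<subseteq> E" for E' t h
  proof (rule down_hull_le)
    show "E' \<subseteq> X" "E' \<noteq> {}"
      using that by (auto simp: approximants_def)
    then show "e \<le> t"
      using h by (auto simp: P_def)
    fix y assume y: "y \<in> E'"
    then have "(h y, 0) \<in> ball_closure X d (down_hull E)"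
      using h down_hull_subset[OF EX] by (intro center_in_ball_closure) (auto simp: down_hull_def ball_trace_def)
    then show "(y, t - e) \<in> ball_closure X d (down_hull E)"
      by (rule closedin_scott_down[OF closedin_ball_closure])
        (use y h \<open>E' \<subseteq> X\<close> \<open>e \<le> t\<close> in \<open>auto simp: P_def\<close>)
  qed
  have "p \<sqsubseteq>\<^bsub>H\<^esub> (down_hull E, e)"
    unfolding p(1) using f by (intro le[OF p(2)]) (auto simp: E_def)
  moreover have "q \<sqsubseteq>\<^bsub>H\<^esub> (down_hull E, e)"
    unfolding q(1) using g by (intro le[OF q(2)]) (auto simp: E_def)
  ultimately show "\<exists>r\<in>{(down_hull E, t) | E t. (E, t) \<in> approximants C}. p \<sqsubseteq>\<^bsub>H\<^esub> r \<and> q \<sqsubseteq>\<^bsub>H\<^esub> r"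
    using E by (intro bexI[of _ "(down_hull E, e)"]) auto
qed

text \<open>Singleton approximants decide leastness: they have arbitrarily small radii, so an upper
  bound has radius 0, and they force the closure of its set to contain every ball way below some
  \<open>(x, 0)\<close> with \<open>x \<in> C\<close>.\<close>

lemma sup_approximants:
  assumes C: "C \<in> K" "C \<noteq> {}"
  shows "is_sup H (C, 0) ({(down_hull E, t) | E t. (E, t) \<in> approximants C})"
proof (subst is_sup_iff)
  let ?D = "{(down_hull E, t) | E t. (E, t) \<in> approximants C}"
  show "?D \<subseteq> carrier H"
    using down_hull_in_K by (auto simp: approximants_def)
  have upper: "p \<sqsubseteq>\<^bsub>H\<^esub> (C, 0)" if "p \<in> ?D" for p
  proof -
    from that obtain E t where p: "p = (down_hull E, t)" "(E, t) \<in> approximants C"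
      by auto
    have Et: "E \<subseteq> X" "E \<noteq> {}" "0 \<le> t"
      using p by (auto simp: approximants_def)
    have "(y, t) \<in> ball_closure X d C" if y: "y \<in> E" for y
    proof -
      obtain x where x: "x \<in> C" "way_below B (y, t) (x, 0)"
        using p y by (auto simp: approximants_def)
      then have "(y, t) \<sqsubseteq>\<^bsub>B\<^esub> (x, 0)"
        using K_subset[OF C(1)] by (intro balls.way_below_imp_le) auto
      then show ?thesis
        using closedin_scott_down[OF closedin_ball_closure
            center_in_ball_closure[OF K_subset[OF C(1)] x(1)]] Et y by auto
    qed
    then show ?thesis
      unfolding p(1) using Et by (intro down_hull_le) simp_all
  qed
  have least: "(C, 0) \<sqsubseteq>\<^bsub>H\<^esub> u" if u: "u \<in> carrier H" "\<forall>p\<in>?D. p \<sqsubseteq>\<^bsub>H\<^esub> u" for u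
  proof -
    obtain C' s where u' [simp]: "u = (C', s)"
      by (metis surj_pair)
    have app: "(down_hull {y}, t) \<sqsubseteq>\<^bsub>H\<^esub> (C', s)"
      if "y \<in> X" "0 \<le> t" "x \<in> C" "way_below B (y, t) (x, 0)" for x y t
    proof -
      have "({y}, t) \<in> approximants C"
        using that by (auto simp: approximants_def)
      then show ?thesis
        using u by force
    qed
    have "s = 0"
    proof (rule ccontr)
      assume "s \<noteq> 0"
      then have s: "s > 0"
        using u by simp
      obtain x where x: "x \<in> C" "x \<in> X"
        using C K_subset by blast
      then have xB: "(x, 0) \<in> carrier B"
        by simp
      obtain y t where y: "y \<in> X" "0 \<le> t" "way_below B (y, t) (x, 0)" "t < s"
        using sup_radius[OF balls.directed_way_below[OF xB] balls.sup_way_below[OF xB] s] by auto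
      then show False
        using app[OF y(1,2) x(1) y(3)] by simp
    qed
    \<comment> \<open>For radii below some \<open>a < A\<close>, the order under
      \<open>(C', 0)\<close> means inclusion in the closure of \<open>C'\<close>. Every ball
      \<open>p\<close> way below \<open>(x, 0)\<close> lies under a ball \<open>(y, t)\<close> with
      \<open>t < a\<close>, so it is in that closure.\<close>
    obtain b where "0 < b" "b < A"
      using dense[OF A] by blast
    then obtain a where a: "0 < a" "ennreal a < A"
      by (cases b) auto
    have "(x, 0) \<in> ball_closure X d C'" if x: "x \<in> C" for x
    proof -
      have xX: "x \<in> X"
        using x C K_subset by blast
      then have xB: "(x, 0) \<in> carrier B"
        by simp
      show ?thesis
      proof (rule closedin_scott_sup[OF closedin_ball_closure balls.directed_way_below[OF xB]
            balls.sup_way_below[OF xB]], rule subsetI)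
        fix p assume "p \<in> {p \<in> carrier B. way_below B p (x, 0)}"
        then have p: "p \<in> carrier B" "way_below B p (x, 0)"
          by blast+
        obtain y t where y: "y \<in> X" "0 \<le> t" "way_below B (y, t) (x, 0)" "way_below B p (y, t)" "t < 0 + a"
          using way_below_small_radius[OF p(1) xX _ p(2) a(1)] by auto
        have "ennreal t \<le> ennreal a"
          using y(5) by (intro ennreal_leI) simp
        then have "\<not> A \<le> ennreal t"
          using a(2) by (metis leD order_le_less_trans)
        moreover have "y \<in> down_hull {y}" "down_hull {y} \<in> K"
          using y(1) down_hull_subset[of "{y}"] down_hull_in_K[of "{y}"] by auto
        ultimately have "(y, t) \<in> ball_closure X d C'"
          using app[OF y(1,2) x y(3)] H_le_iff[of "down_hull {y}" t C' s] \<open>s = 0\<close> by auto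
        moreover have "p \<sqsubseteq>\<^bsub>B\<^esub> (y, t)"
          using y by (intro balls.way_below_imp_le) auto
        ultimately show "p \<in> ball_closure X d C'"
          using closedin_scott_down[OF closedin_ball_closure] p(1) by blast
      qed
    qed
    then show ?thesis
      using C \<open>s = 0\<close> by (simp add: H_le_iff del: formal_balls_simps)
  qed
  show "(C, 0) \<in> carrier H \<and> (\<forall>p\<in>?D. p \<sqsubseteq>\<^bsub>H\<^esub> (C, 0)) \<and>
    (\<forall>u\<in>carrier H. (\<forall>p\<in>?D. p \<sqsubseteq>\<^bsub>H\<^esub> u) \<longrightarrow> (C, 0) \<sqsubseteq>\<^bsub>H\<^esub> u)"
  proof (intro conjI ballI impI)
    show "(C, 0) \<in> carrier H"
      using C by simp
  qed (use upper least in blast)+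
qed

section \<open>Comparison with the lower Vietoris topology\<close>

abbreviation LV where "LV \<equiv> lower_vietoris (d_scott_topology X d) K"

lemma openin_vietoris_hit:
  "openin (d_scott_topology X d) U \<Longrightarrow> openin LV {C \<in> K. C \<inter> U \<noteq> {}}"
  unfolding lower_vietoris_def by (rule topology_generated_by_Basis) blast

lemma scott_open_vietoris_neighbourhood:
  assumes W: "scott_open H W" and C: "C \<in> K" "(C, 0) \<in> W"
  shows "\<exists>T. openin LV T \<and> C \<in> T \<and> T \<subseteq> {C \<in> K. (C, 0) \<in> W}"
proof (cases "C = {}")
  \<comment> \<open>The ball over the empty set is below every \<open>(C', 0)\<close>, so the whole
    of \<open>K\<close> serves as the neighbourhood.\<close>
  case True
  have "(C', 0) \<in> W" if "C' \<in> K" for C'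
  proof -
    have "(C, 0) \<sqsubseteq>\<^bsub>H\<^esub> (C', 0)"
      using H_le_iff[OF C(1), of 0 C' 0] True by simp
    then show ?thesis
      using scott_open_up[OF W C(2)] that by simp
  qed
  moreover have "openin LV K"
    using openin_topspace[of LV] by simp
  ultimately show ?thesis
    using C by blast
next
  case False
  obtain E t where E: "(E, t) \<in> approximants C" "(down_hull E, t) \<in> W"
    using scott_open_sup[OF W directed_approximants[OF C(1) False] sup_approximants[OF C(1) False] C(2)]
    by auto
  then have Et: "finite E" "E \<noteq> {}" "E \<subseteq> X" "0 \<le> t" "\<forall>y\<in>E. \<exists>x\<in>C. way_below B (y, t) (x, 0)"
    by (auto simp: approximants_def)
  define U where "U y = {x \<in> X. way_below B (y, t) (x, 0)}" for y
  have U: "openin (d_scott_topology X d) (U y)" if "y \<in> E" for y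
  proof -
    have "scott_open B {p \<in> carrier B. way_below B (y, t) p}"
      using that Et by (intro balls.scott_open_way_below) auto
    moreover have "U y = {x \<in> X. (x, 0) \<in> {p \<in> carrier B. way_below B (y, t) p}}"
      by (auto simp: U_def)
    ultimately show ?thesis
      unfolding openin_d_scott_iff by blast
  qed
  have "openin LV (\<Inter>y\<in>E. {C \<in> K. C \<inter> U y \<noteq> {}})"
    using Et U by (intro openin_INT2 openin_vietoris_hit) auto
  moreover have "C \<in> (\<Inter>y\<in>E. {C \<in> K. C \<inter> U y \<noteq> {}})"
    using Et(5) C(1) K_subset[OF C(1)] by (fastforce simp: U_def)
  moreover have "(C', 0) \<in> W" "C' \<in> K" if C': "C' \<in> (\<Inter>y\<in>E. {C \<in> K. C \<inter> U y \<noteq> {}})" for C'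
  proof -
    show K': "C' \<in> K"
      using C' Et(2) by blast
    \<comment> \<open>Hitting \<open>U y\<close> puts \<open>(y, t)\<close> below a center in
      \<open>C'\<close>, hence into the closure of \<open>C'\<close>; for all
      \<open>y \<in> E\<close> together this is the required inequality.\<close>
    have "(down_hull E, t) \<sqsubseteq>\<^bsub>H\<^esub> (C', 0)"
    proof (rule down_hull_le[OF Et(3,2,4)])
      fix y assume y: "y \<in> E"
      then obtain x where x: "x \<in> C'" "x \<in> X" "way_below B (y, t) (x, 0)"
        using C' by (auto simp: U_def)
      then have "(y, t) \<sqsubseteq>\<^bsub>B\<^esub> (x, 0)"
        by (intro balls.way_below_imp_le) auto
      then show "(y, t - 0) \<in> ball_closure X d C'"
        using closedin_scott_down[OF closedin_ball_closure
            center_in_ball_closure[OF K_subset[OF K'] x(1)]] Et y by auto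
    qed
    then show "(C', 0) \<in> W"
      using scott_open_up[OF W E(2)] K' by simp
  qed
  ultimately show ?thesis
    by blast
qed

lemma d_scott_eq_lower_vietoris: "d_scott_topology K dK = LV"
  unfolding topology_eq
proof (intro allI iffI)
  fix S assume "openin (d_scott_topology K dK) S"
  then obtain W where W: "scott_open H W" "S = (\<lambda>C. (C, 0)) -` W \<inter> K"
    by (auto simp: d_scott_topology_def openin_pullback_topology)
  then have "S = {C \<in> K. (C, 0) \<in> W}"
    by auto
  then show "openin LV S"
    using scott_open_vietoris_neighbourhood[OF W(1)] by (subst openin_subopen) blast
next
  fix S assume "openin LV S"
  then have "generate_topology_on (insert K {{C \<in> K. C \<inter> U \<noteq> {}} | U. openin (d_scott_topology X d) U}) S"
    by (simp add: lower_vietoris_def openin_topology_generated_by_iff)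
  then show "openin (d_scott_topology K dK) S"
  proof (rule generate_topology_on_coarsest[OF istopology_openin, rotated])
    fix s assume "s \<in> insert K {{C \<in> K. C \<inter> U \<noteq> {}} | U. openin (d_scott_topology X d) U}"
    moreover have "openin (d_scott_topology K dK) K"
      using openin_topspace[of "d_scott_topology K dK"] by simp
    ultimately show "openin (d_scott_topology K dK) s"
      using openin_hit by blast
  qed
qed

end

section \<open>Specialization to the two hyperspaces and to each cut-off\<close>

theorem theorem12p26:
  fixes X :: "'a set" and d :: "'a \<Rightarrow> 'a \<Rightarrow> ennreal"
  assumes "continuous_yoneda_complete X d"
  shows "(d_scott_topology (hyperspace0 X d) (hausdorff_qm X d)
            = lower_vietoris (d_scott_topology X d) (hyperspace0 X d) \<and>
          (\<forall>a::real. a > 0 \<longrightarrow>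
            d_scott_topology (hyperspace0 X d) (bounded_hausdorff_qm a X d)
              = lower_vietoris (d_scott_topology X d) (hyperspace0 X d))) \<and>
         (d_scott_topology (hyperspace X d) (hausdorff_qm X d)
            = lower_vietoris (d_scott_topology X d) (hyperspace X d) \<and>
          (\<forall>a::real. a > 0 \<longrightarrow>
            d_scott_topology (hyperspace X d) (bounded_hausdorff_qm a X d)
              = lower_vietoris (d_scott_topology X d) (hyperspace X d)))"
proof -
  have eq: "d_scott_topology K (\<lambda>C C'. min A (hausdorff_qm X d C C')) =
      lower_vietoris (d_scott_topology X d) K"
    if "K = hyperspace0 X d \<or> K = hyperspace X d" "0 < A" for K A
  proof -
    interpret hyperspace_balls X d K A
      using assms that by unfold_locales (auto simp: hyperspace_def hyperspace0_def)
    show ?thesis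
      by (rule d_scott_eq_lower_vietoris)
  qed
  have "hausdorff_qm X d = (\<lambda>C C'. min \<infinity> (hausdorff_qm X d C C'))"
    by (auto simp: fun_eq_iff)
  then have unbounded: "d_scott_topology K (hausdorff_qm X d) = lower_vietoris (d_scott_topology X d) K"
    if "K = hyperspace0 X d \<or> K = hyperspace X d" for K
    using eq[OF that, of \<infinity>] by simp
  have "bounded_hausdorff_qm a X d = (\<lambda>C C'. min (ennreal a) (hausdorff_qm X d C C'))" for a
    by (auto simp: fun_eq_iff bounded_hausdorff_qm_def)
  then have bounded: "d_scott_topology K (bounded_hausdorff_qm a X d) = lower_vietoris (d_scott_topology X d) K"
    if "K = hyperspace0 X d \<or> K = hyperspace X d" "0 < a" for K a
    using eq[OF that(1), of "ennreal a"] that(2) by simp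
  show ?thesis
    by (intro conjI allI impI unbounded bounded) simp_all
qed

end
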